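(* Let $J:\mathbb{R}^N\to\mathbb{R}$ satisfy hypothesis (H) below. Let $\Omega\subset\mathbb{R}^N$ be a bounded open set and let $\Omega_n\subset\mathbb{R}^N$ be a sequence of bounded open sets with $$|\Omega\setminus\Omega_n|+|\Omega_n\setminus\Omega|\to 0\quad\text{as } n\to\infty .$$ Then, if $\mu(\Omega)$ is an eigenvalue of $\mathcal{J}_\Omega$, there exists a sequence of eigenvalues $\mu(\Omega_n)\in\sigma(\mathcal{J}_{\Omega_n})$ such that $\mu(\Omega_n)\to\mu(\Omega)$ as $n\to\infty$. In particular, if $\lambda(\Omega)$ is an eigenvalue of $\mathcal{B}_\Omega$, there exists a sequence of eigenvalues $\lambda(\Omega_n)\in\sigma(\mathcal{B}_{\Omega_n})$ with $\lambda(\Omega_n)\to\lambda(\Omega)$ as $n\to\infty$.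
   Context: Hypothesis (H): $J\in\mathcal{C}(\mathbb{R}^N,\mathbb{R})$ is nonnegative, spherically symmetric and radially decreasing, with $J(0)>0$ and $\int_{\mathbb{R}^N}J(x)\,dx=1$. $|\cdot|$ denotes Lebesgue measure. For a bounded open set $U\subset\mathbb{R}^N$, $\mathcal{J}_U:L^2(U)\to L^2(U)$ is the (compact, self-adjoint) operator $\mathcal{J}_U u(x)=\int_U J(x-y)u(y)\,dy$, $x\in U$, and $\mathcal{B}_U:W_U\to W_U$, where $W_U=\{u\in L^2(\mathbb{R}^N): u\equiv 0 \text{ in } \mathbb{R}^N\setminus U\}$, is $\mathcal{B}_U u(x)=u(x)-\int_U J(x-y)u(y)\,dy$ for $x\in U$. Thus $\lambda$ is an eigenvalue of $\mathcal{B}_U$ iff there is $u\neq 0$ in $L^2(\mathbb{R}^N)$, $u\equiv0$ off $U$, with $(J*u)(x)-u(x)=-\lambda u(x)$ for $x\in U$.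
   Formalization: The members of the sequences are claimed to be eigenvalues for Ω_n only for all sufficiently large n, since some of the first Ω_n may be empty, in which case L²(Ω_n) = {0} and there are no eigenvalues. *)

theory Defs
  imports "HOL-Analysis.Analysis"
begin

definition hypH :: "('a::euclidean_space \<Rightarrow> real) \<Rightarrow> bool" where
  "hypH J \<longleftrightarrow> continuous_on UNIV J
     \<and> (\<forall>x. 0 \<le> J x)
     \<and> (\<forall>x y. norm x = norm y \<longrightarrow> J x = J y)
     \<and> (\<forall>x y. norm x \<le> norm y \<longrightarrow> J y \<le> J x)
     \<and> J 0 > 0
     \<and> integrable lborel J \<and> integral\<^sup>L lborel J = 1"

definition eigenvalue_JU :: "('a::euclidean_space \<Rightarrow> real) \<Rightarrow> 'a set \<Rightarrow> real \<Rightarrow> bool" where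
  "eigenvalue_JU J U \<mu> \<longleftrightarrow>
     (\<exists>u::'a \<Rightarrow> real. u \<in> borel_measurable lebesgue
        \<and> set_integrable lebesgue U (\<lambda>x. (u x)\<^sup>2)
        \<and> \<not> (AE x in lebesgue. x \<in> U \<longrightarrow> u x = 0)
        \<and> (AE x in lebesgue. x \<in> U \<longrightarrow>
              (LINT y:U|lebesgue. J (x - y) * u y) = \<mu> * u x))"

definition eigenvalue_BU :: "('a::euclidean_space \<Rightarrow> real) \<Rightarrow> 'a set \<Rightarrow> real \<Rightarrow> bool" where
  "eigenvalue_BU J U lam \<longleftrightarrow>
     (\<exists>u::'a \<Rightarrow> real. u \<in> borel_measurable lebesgue
        \<and> integrable lebesgue (\<lambda>x. (u x)\<^sup>2)
        \<and> (\<forall>x. x \<notin> U \<longrightarrow> u x = 0)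
        \<and> \<not> (AE x in lebesgue. u x = 0)
        \<and> (AE x in lebesgue. x \<in> U \<longrightarrow>
              (LINT y|lebesgue. J (x - y) * u y) - u x = - lam * u x))"

end

theory Submission
  imports Defs "HOL-Complex_Analysis.Great_Picard"
begin

text \<open>
  Let \<open>T\<close> be a compact symmetric operator and \<open>\<parallel>T v - \<mu> v\<parallel> < \<epsilon> \<parallel>v\<parallel>\<close>. Then \<open>T\<close> has an eigenvalue
  within \<open>\<epsilon>\<close> of \<open>\<mu>\<close>, provided \<open>\<epsilon> \<le> \<bar>\<mu>\<bar>\<close> or \<open>\<mu> = 0\<close>: for \<open>\<mu> \<noteq> 0\<close>, minimise the compact form
  \<open>\<parallel>(T - \<mu>) x\<parallel>\<^sup>2 - \<mu>\<^sup>2 \<parallel>x\<parallel>\<^sup>2\<close> on the unit sphere and factor the resulting eigenvalue equation of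
  \<open>(T - \<mu>)\<^sup>2\<close>; for \<open>\<mu> = 0\<close>, either this applies to \<open>T\<^sup>2\<close>, or \<open>T\<close> is bounded below on its range
  and the component of \<open>v\<close> orthogonal to the range of \<open>T\<^sup>2\<close> is a nonzero kernel vector. An
  eigenfunction \<open>u\<close> on \<open>\<Omega>\<close>, extended by zero, is such an approximate eigenvector on \<open>\<Omega>n n\<close>, since
  its residual there is controlled by the integrals of \<open>\<bar>u\<bar>\<close> over \<open>\<Omega> - \<Omega>n n\<close> and the measure of
  \<open>\<Omega>n n - \<Omega>\<close>.
\<close>

section \<open>Approximate eigenvectors of compact symmetric operators\<close>

text \<open>
  Completeness is never needed: every limit is taken inside the image of a bounded sequence
  under \<open>T\<close>, where \<open>T_compact\<close> below provides it.
\<close>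

locale semi_inner_product =
  fixes ip :: "'v::real_vector \<Rightarrow> 'v \<Rightarrow> real"
  assumes ip_commute: "ip x y = ip y x"
    and ip_add_left: "ip (x + y) z = ip x z + ip y z"
    and ip_scaleR_left: "ip (c *\<^sub>R x) z = c * ip x z"
    and ip_nonneg: "0 \<le> ip x x"
begin

definition nrm :: "'v \<Rightarrow> real" where
  "nrm x = sqrt (ip x x)"

lemma ip_add_right: "ip z (x + y) = ip z x + ip z y"
  by (metis ip_add_left ip_commute)

lemma ip_scaleR_right: "ip z (c *\<^sub>R x) = c * ip z x"
  by (metis ip_scaleR_left ip_commute)

lemma ip_diff_left: "ip (x - y) z = ip x z - ip y z"
  using ip_add_left[of "x - y" y z] by simp

lemma ip_diff_right: "ip z (x - y) = ip z x - ip z y"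
  by (metis ip_diff_left ip_commute)

lemmas ip_linear =
  ip_add_left ip_add_right ip_scaleR_left ip_scaleR_right ip_diff_left ip_diff_right

lemma nrm_nonneg [simp]: "0 \<le> nrm x"
  by (simp add: nrm_def ip_nonneg)

lemma nrm_square: "(nrm x)\<^sup>2 = ip x x"
  by (simp add: nrm_def ip_nonneg)

text \<open>The quadratic polynomial \<open>ip (x - t *\<^sub>R y) (x - t *\<^sub>R y)\<close> in
  \<open>t\<close> is nonnegative; its value at the minimiser \<open>ip x y / ip y y\<close> is the
  claim. Since \<open>ip\<close> may be degenerate, \<open>ip y y = 0\<close> is a separate case,
  where the polynomial is affine in \<open>t\<close> and stays nonnegative only if it is
  constant.\<close>

lemma Cauchy_Schwarz: "(ip x y)\<^sup>2 \<le> ip x x * ip y y"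
proof -
  have q: "0 \<le> ip x x - 2 * t * ip x y + t\<^sup>2 * ip y y" for t
    using ip_nonneg[of "x - t *\<^sub>R y"]
    by (simp add: ip_linear ip_commute[of y x] power2_eq_square algebra_simps)
  show ?thesis
  proof (cases "ip y y = 0")
    case True
    have "ip x y = 0"
    proof (rule ccontr)
      assume "ip x y \<noteq> 0"
      then show False
        \<comment> \<open>At this \<open>t\<close> the affine function takes the value -1.\<close>
        using q[of "(ip x x + 1) / (2 * ip x y)"] True by simp
    qed
    with True show ?thesis by simp
  next
    case False
    then have "0 < ip y y" using ip_nonneg[of y] by simp
    then show ?thesis
      using q[of "ip x y / ip y y"] by (simp add: field_simps power2_eq_square)
  qed
qed

lemma ip_le_nrm: "\<bar>ip x y\<bar> \<le> nrm x * nrm y"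
proof -
  have "sqrt ((ip x y)\<^sup>2) \<le> sqrt (ip x x * ip y y)"
    using Cauchy_Schwarz real_sqrt_le_mono by blast
  then show ?thesis by (simp add: nrm_def real_sqrt_mult)
qed

lemma nrm_triangle: "nrm (x + y) \<le> nrm x + nrm y"
proof (rule power2_le_imp_le)
  have "(nrm (x + y))\<^sup>2 = (nrm x)\<^sup>2 + 2 * ip x y + (nrm y)\<^sup>2"
    by (simp add: nrm_square ip_linear ip_commute[of y x])
  also have "\<dots> \<le> (nrm x + nrm y)\<^sup>2"
    using ip_le_nrm[of x y] by (simp add: power2_sum)
  finally show "(nrm (x + y))\<^sup>2 \<le> (nrm x + nrm y)\<^sup>2" .
qed simp

lemma nrm_scaleR: "nrm (c *\<^sub>R x) = \<bar>c\<bar> * nrm x"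
  by (simp add: nrm_def ip_linear real_sqrt_mult flip: power2_eq_square mult.assoc)

lemma nrm_minus_commute: "nrm (x - y) = nrm (y - x)"
  using nrm_scaleR[of "-1" "x - y"] by simp

lemma nrm_triangle_diff: "nrm (x - z) \<le> nrm (x - y) + nrm (y - z)"
  using nrm_triangle[of "x - y" "y - z"] by simp

lemma nrm_diff_le: "nrm x - nrm y \<le> nrm (x - y)"
  using nrm_triangle[of "x - y" y] by simp

lemma tendsto_nrm:
  assumes "(\<lambda>n. nrm (v n - g)) \<longlonglongrightarrow> 0"
  shows "(\<lambda>n. nrm (v n)) \<longlonglongrightarrow> nrm g"
proof -
  have "\<bar>nrm (v n) - nrm g\<bar> \<le> nrm (v n - g)" for n
    using nrm_diff_le[of "v n" g] nrm_diff_le[of g "v n"] nrm_minus_commute[of g "v n"] by linarith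
  then have "(\<lambda>n. nrm (v n) - nrm g) \<longlonglongrightarrow> 0"
    by (intro tendsto_rabs_zero_cancel[OF tendsto_sandwich[OF _ _ tendsto_const assms]]) auto
  then show ?thesis by (simp add: LIM_zero_iff)
qed

end

section \<open>Compact symmetric operators: eigenvalues from minimisation and factorisation\<close>

locale compact_symmetric = semi_inner_product ip for ip :: "'v::real_vector \<Rightarrow> 'v \<Rightarrow> real" +
  fixes T :: "'v \<Rightarrow> 'v"
  assumes T_add: "T (x + y) = T x + T y"
    and T_scaleR: "T (c *\<^sub>R x) = c *\<^sub>R T x"
    and T_symmetric: "ip (T x) y = ip x (T y)"
    and T_bounded: "\<exists>C. \<forall>x. nrm (T x) \<le> C * nrm x"
    and T_compact: "\<And>v :: nat \<Rightarrow> 'v. (\<And>n. nrm (v n) \<le> 1) \<Longrightarrow>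
       \<exists>r g. strict_mono r \<and> (\<lambda>n. nrm (T (v (r n)) - g)) \<longlonglongrightarrow> 0"
begin

lemma T_diff: "T (x - y) = T x - T y"
  using T_add[of "x - y" y] by simp

lemma T_bound_obtain:
  obtains C where "C > 0" "\<And>x. nrm (T x) \<le> C * nrm x"
proof -
  obtain C where C: "\<And>x. nrm (T x) \<le> C * nrm x" using T_bounded by blast
  have "nrm (T x) \<le> (\<bar>C\<bar> + 1) * nrm x" for x
    by (rule order_trans[OF C mult_right_mono]) auto
  then show thesis by (intro that[of "\<bar>C\<bar> + 1"]) auto
qed

lemma compact_bounded_sequence:
  fixes v :: "nat \<Rightarrow> 'v"
  assumes "\<And>n. nrm (v n) \<le> B"
  obtains r g where "strict_mono r" "(\<lambda>n. nrm (T (v (r n)) - g)) \<longlonglongrightarrow> 0"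
proof -
  \<comment> \<open>The added 1 keeps \<open>b\<close> positive even when \<open>B = 0\<close>, so
    that the sequence can be scaled into the unit ball.\<close>
  define b where "b = \<bar>B\<bar> + 1"
  have b: "b > 0" "\<And>n. nrm (v n) \<le> b"
    using assms by (auto simp: b_def) (smt (verit))
  have "nrm ((1 / b) *\<^sub>R v n) \<le> 1" for n
    using b by (simp add: nrm_scaleR)
  from T_compact[of "\<lambda>n. (1 / b) *\<^sub>R v n", OF this]
  obtain r g where r: "strict_mono r"
    and g: "(\<lambda>n. nrm (T ((1 / b) *\<^sub>R v (r n)) - g)) \<longlonglongrightarrow> 0"
    by blast
  have "nrm (T (v (r n)) - b *\<^sub>R g) = b * nrm (T ((1 / b) *\<^sub>R v (r n)) - g)" for n
    using nrm_scaleR[of b "T ((1 / b) *\<^sub>R v (r n)) - g"] b(1)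
    by (simp add: T_scaleR scaleR_diff_right)
  with tendsto_mult_left[OF g, of b] show thesis
    by (intro that[OF r, of "b *\<^sub>R g"]) simp
qed

lemma tendsto_T:
  assumes "(\<lambda>n. nrm (v n - g)) \<longlonglongrightarrow> 0"
  shows "(\<lambda>n. nrm (T (v n) - T g)) \<longlonglongrightarrow> 0"
proof -
  obtain C where C: "\<And>x. nrm (T x) \<le> C * nrm x" using T_bounded by blast
  show ?thesis
  proof (rule tendsto_sandwich[OF _ _ tendsto_const])
    show "(\<lambda>n. C * nrm (v n - g)) \<longlonglongrightarrow> 0"
      using tendsto_mult_left[OF assms, of C] by simp
  qed (use C in \<open>auto simp flip: T_diff\<close>)
qed

text \<open>Factored as \<open>T\<close> after the bounded map \<open>T + c\<close>, the operator
  first sends a bounded sequence to a bounded one and then applies the compact \<open>T\<close>. It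
  is used with \<open>c = 0\<close> for the square of \<open>T\<close> and with
  \<open>c = -2\<mu>\<close> for the square of \<open>T - \<mu>\<close> without its multiple of the
  identity.\<close>

lemma compact_symmetric_quadratic: "compact_symmetric ip (\<lambda>x. T (T x) + c *\<^sub>R T x)"
proof
  obtain C where C: "C > 0" "\<And>x. nrm (T x) \<le> C * nrm x" by (rule T_bound_obtain) blast
  have B: "nrm (T x + c *\<^sub>R x) \<le> (C + \<bar>c\<bar>) * nrm x" for x
    using nrm_triangle[of "T x" "c *\<^sub>R x"] C(2)[of x] by (simp add: nrm_scaleR algebra_simps)
  have eq: "T (T x) + c *\<^sub>R T x = T (T x + c *\<^sub>R x)" for x
    by (simp add: T_add T_scaleR)
  show "\<exists>C. \<forall>x. nrm (T (T x) + c *\<^sub>R T x) \<le> C * nrm x"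
  proof (intro exI allI)
    fix x
    have "nrm (T (T x + c *\<^sub>R x)) \<le> C * nrm (T x + c *\<^sub>R x)" by (rule C)
    also have "\<dots> \<le> C * ((C + \<bar>c\<bar>) * nrm x)"
      using B[of x] C(1) by (intro mult_left_mono) auto
    finally show "nrm (T (T x) + c *\<^sub>R T x) \<le> C * (C + \<bar>c\<bar>) * nrm x"
      unfolding eq by simp
  qed
  show "\<exists>r g. strict_mono r \<and> (\<lambda>n. nrm (T (T (v (r n))) + c *\<^sub>R T (v (r n)) - g)) \<longlonglongrightarrow> 0"
    if v: "\<And>n. nrm (v n) \<le> 1" for v :: "nat \<Rightarrow> 'v"
  proof -
    have "nrm (T (v n) + c *\<^sub>R v n) \<le> C + \<bar>c\<bar>" for n
      using B[of "v n"] mult_left_mono[OF v[of n], of "C + \<bar>c\<bar>"] C(1) by simp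
    then obtain r g where "strict_mono r"
      "(\<lambda>n. nrm (T (T (v (r n)) + c *\<^sub>R v (r n)) - g)) \<longlonglongrightarrow> 0"
      by (rule compact_bounded_sequence)
    then show ?thesis unfolding eq by (intro exI conjI)
  qed
qed (simp_all add: T_add T_scaleR T_symmetric ip_linear algebra_simps)

text \<open>The infimum \<open>\<kappa>\<close> of the Rayleigh quotient is negative, and
  compactness makes a minimising sequence converge along a subsequence to an eigenvector. The bound
  of \<open>\<kappa>\<close> by the quotient at \<open>w\<close> is kept because it later locates
  the eigenvalue.\<close>

lemma negative_eigenvalue:
  assumes neg: "ip (T w) w < 0"
  obtains \<kappa> g where "\<kappa> * ip w w \<le> ip (T w) w" "nrm g \<noteq> 0" "nrm (T g - \<kappa> *\<^sub>R g) = 0"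
proof -
  obtain C where C: "C > 0" "\<And>x. nrm (T x) \<le> C * nrm x" by (rule T_bound_obtain) blast
  define R where "R = {ip (T x) x | x. ip x x = 1}"
  define \<kappa> where "\<kappa> = Inf R"
  have "nrm w \<noteq> 0" using neg ip_le_nrm[of "T w" w] by auto
  then have w: "ip w w > 0" using nrm_square[of w] by (metis zero_less_power2)
  have ip_T: "\<bar>ip (T x) x\<bar> \<le> C * ip x x" for x
  proof -
    have "\<bar>ip (T x) x\<bar> \<le> nrm (T x) * nrm x" by (rule ip_le_nrm)
    also have "\<dots> \<le> C * nrm x * nrm x" using C(2) by (intro mult_right_mono) auto
    finally show ?thesis by (simp add: power2_eq_square flip: nrm_square)
  qed
  have bdd: "bdd_below R"
    using ip_T by (auto simp: R_def intro!: bdd_belowI[of _ "-C"]) (smt (verit) mult_cancel_left1)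
  have \<kappa>_le: "\<kappa> * ip x x \<le> ip (T x) x" for x
  proof (cases "ip x x = 0")
    case True
    then show ?thesis using ip_T[of x] by simp
  next
    case False
    then have pos: "ip x x > 0" using ip_nonneg[of x] by simp
    define y where "y = (1 / sqrt (ip x x)) *\<^sub>R x"
    have "ip y y = 1" using pos by (simp add: y_def ip_linear)
    then have "ip (T y) y \<in> R" by (auto simp: R_def)
    then have "\<kappa> \<le> ip (T y) y" unfolding \<kappa>_def by (rule cInf_lower[OF _ bdd])
    also have "ip (T y) y = ip (T x) x / ip x x"
      using pos by (simp add: y_def ip_linear T_scaleR)
    finally show ?thesis using pos by (simp add: field_simps)
  qed
  have "\<kappa> < 0" using \<kappa>_le[of w] neg w by (smt (verit) mult_nonneg_nonneg)
  have ne: "R \<noteq> {}"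
  proof -
    have "ip ((1 / sqrt (ip w w)) *\<^sub>R w) ((1 / sqrt (ip w w)) *\<^sub>R w) = 1"
      using w by (simp add: ip_linear)
    then show ?thesis unfolding R_def by blast
  qed
  \<comment> \<open>The form of \<open>T - \<kappa>\<close>. It is nonnegative because
    \<open>\<kappa>\<close> is the infimum, so Cauchy-Schwarz holds for it too.\<close>
  define A where "A x y = ip (T x) y - \<kappa> * ip x y" for x y
  interpret A: semi_inner_product A
  proof
    show "A x y = A y x" for x y
      unfolding A_def by (metis T_symmetric ip_commute)
    show "0 \<le> A x x" for x using \<kappa>_le[of x] by (simp add: A_def)
  qed (simp_all add: A_def ip_linear T_add T_scaleR algebra_simps)
  define D where "D = C + \<bar>\<kappa>\<bar>"
  \<comment> \<open>Cauchy-Schwarz for \<open>A\<close> at \<open>x\<close> and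
    \<open>y = T x - \<kappa> x\<close>, where \<open>A x y = ip y y\<close>, shows that an almost
    minimising \<open>x\<close> is almost an eigenvector.\<close>
  have residual: "(nrm (T x - \<kappa> *\<^sub>R x))\<^sup>2 \<le> D * A x x" for x
  proof -
    define y where "y = T x - \<kappa> *\<^sub>R x"
    have yy: "ip y y = A x y" by (simp add: A_def y_def ip_linear T_symmetric[of x x] algebra_simps)
    have "A y y \<le> D * ip y y"
      using ip_T[of y] \<open>\<kappa> < 0\<close> by (simp add: A_def D_def algebra_simps)
    then have "A x x * A y y \<le> A x x * (D * ip y y)"
      by (intro mult_left_mono A.ip_nonneg)
    then have "ip y y * ip y y \<le> (D * A x x) * ip y y"
      using A.Cauchy_Schwarz[of x y] by (simp add: yy power2_eq_square algebra_simps)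
    moreover have "0 \<le> D * A x x" using C(1) A.ip_nonneg[of x] by (simp add: D_def)
    ultimately have "ip y y \<le> D * A x x"
      using ip_nonneg[of y] by (cases "ip y y = 0") auto
    then show ?thesis by (simp add: nrm_square y_def)
  qed
  have "\<exists>v. ip v v = 1 \<and> A v v < 1 / real (Suc n)" for n
  proof -
    have "\<exists>z\<in>R. z < \<kappa> + 1 / real (Suc n)"
      unfolding \<kappa>_def by (rule cInf_lessD[OF ne]) simp
    then show ?thesis by (fastforce simp: R_def A_def)
  qed
  then obtain v where v: "\<And>n. ip (v n) (v n) = 1" "\<And>n. A (v n) (v n) < 1 / real (Suc n)"
    by metis
  have nv: "nrm (v n) = 1" for n using v(1)[of n] by (simp add: nrm_def)
  have A0: "(\<lambda>n. A (v n) (v n)) \<longlonglongrightarrow> 0"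
    by (rule tendsto_sandwich[OF _ _ tendsto_const LIMSEQ_inverse_real_of_nat])
       (use v(2) A.ip_nonneg in \<open>auto simp: inverse_eq_divide intro!: always_eventually less_imp_le\<close>)
  have "(\<lambda>n. (nrm (T (v n) - \<kappa> *\<^sub>R v n))\<^sup>2) \<longlonglongrightarrow> 0"
    by (rule tendsto_sandwich[OF _ _ tendsto_const])
       (use residual tendsto_mult_left[OF A0, of D] in \<open>auto intro!: always_eventually\<close>)
  then have res0: "(\<lambda>n. nrm (T (v n) - \<kappa> *\<^sub>R v n)) \<longlonglongrightarrow> 0"
    by (simp add: tendsto_null_power)
  obtain r g where r: "strict_mono r" and g: "(\<lambda>n. nrm (T (v (r n)) - g)) \<longlonglongrightarrow> 0"
    by (rule compact_bounded_sequence[of v 1]) (simp add: nv)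
  have res0r: "(\<lambda>n. nrm (T (v (r n)) - \<kappa> *\<^sub>R v (r n))) \<longlonglongrightarrow> 0"
    using LIMSEQ_subseq_LIMSEQ[OF res0 r] by (simp add: o_def)
  \<comment> \<open>The residuals tend to 0, so \<open>\<kappa> v\<close> has the same limit as
    \<open>T v\<close>. The \<open>v\<close> are unit vectors and \<open>\<kappa>\<close> is
    nonzero, hence the limit \<open>g\<close> is not a null vector.\<close>
  have vg: "(\<lambda>n. nrm (\<kappa> *\<^sub>R v (r n) - g)) \<longlonglongrightarrow> 0"
  proof (rule tendsto_sandwich[OF _ _ tendsto_const])
    show "(\<lambda>n. nrm (T (v (r n)) - \<kappa> *\<^sub>R v (r n)) + nrm (T (v (r n)) - g)) \<longlonglongrightarrow> 0"
      using tendsto_add[OF res0r g] by simp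
    show "\<forall>\<^sub>F n in sequentially. nrm (\<kappa> *\<^sub>R v (r n) - g)
        \<le> nrm (T (v (r n)) - \<kappa> *\<^sub>R v (r n)) + nrm (T (v (r n)) - g)"
      using nrm_triangle_diff nrm_minus_commute by (metis (no_types, lifting) always_eventually)
  qed simp
  have "nrm g = \<bar>\<kappa>\<bar>"
    using tendsto_nrm[OF vg] by (simp add: nrm_scaleR nv LIMSEQ_const_iff)
  \<comment> \<open>The left side does not depend on \<open>n\<close>: the eigenvalue equation is
    the limit of the identity \<open>T (\<kappa> v) = \<kappa> T v\<close>.\<close>
  have "(\<lambda>n. nrm (T g - \<kappa> *\<^sub>R g)) \<longlonglongrightarrow> 0"
  proof (rule tendsto_sandwich[OF _ _ tendsto_const])
    show "(\<lambda>n. nrm (T (\<kappa> *\<^sub>R v (r n)) - T g) + \<bar>\<kappa>\<bar> * nrm (T (v (r n)) - g)) \<longlonglongrightarrow> 0"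
      using tendsto_add[OF tendsto_T[OF vg] tendsto_mult_left[OF g, of "\<bar>\<kappa>\<bar>"]] by simp
    show "\<forall>\<^sub>F n in sequentially. nrm (T g - \<kappa> *\<^sub>R g)
        \<le> nrm (T (\<kappa> *\<^sub>R v (r n)) - T g) + \<bar>\<kappa>\<bar> * nrm (T (v (r n)) - g)"
    proof (intro always_eventually allI)
      fix n
      have "nrm (T (\<kappa> *\<^sub>R v (r n)) - \<kappa> *\<^sub>R g) = \<bar>\<kappa>\<bar> * nrm (T (v (r n)) - g)"
        by (simp add: T_scaleR nrm_scaleR flip: scaleR_diff_right)
      then show "nrm (T g - \<kappa> *\<^sub>R g)
          \<le> nrm (T (\<kappa> *\<^sub>R v (r n)) - T g) + \<bar>\<kappa>\<bar> * nrm (T (v (r n)) - g)"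
        using nrm_triangle_diff[of "T g" "\<kappa> *\<^sub>R g" "T (\<kappa> *\<^sub>R v (r n))"]
          nrm_minus_commute[of "T g"] by simp
    qed
  qed simp
  then have "nrm (T g - \<kappa> *\<^sub>R g) = 0" by (simp add: LIMSEQ_const_iff)
  with \<kappa>_le[of w] \<open>nrm g = \<bar>\<kappa>\<bar>\<close> \<open>\<kappa> < 0\<close> show thesis by (intro that) auto
qed

text \<open>The operator \<open>K\<close>, which is
  \<open>(T - \<mu>)\<^sup>2 - \<mu>\<^sup>2\<close>, has a negative form at \<open>v\<close>, hence
  an eigenvalue \<open>\<kappa>\<close> with
  \<open>0 \<le> \<kappa> + \<mu>\<^sup>2 < \<epsilon>\<^sup>2\<close>. With \<open>s\<close> the
  square root of that sum, \<open>K - \<kappa>\<close> is the product of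
  \<open>T - (\<mu> + s)\<close> and \<open>T - (\<mu> - s)\<close>, so one of the two factors has a
  kernel vector.\<close>

lemma eigenvalue_near_nonzero:
  assumes v: "nrm (T v - \<mu> *\<^sub>R v) < \<epsilon> * nrm v" and "\<epsilon> \<le> \<bar>\<mu>\<bar>"
  obtains m w where "\<bar>m - \<mu>\<bar> < \<epsilon>" "nrm w \<noteq> 0" "nrm (T w - m *\<^sub>R w) = 0"
proof -
  define K where "K x = T (T x) + (- \<mu> - \<mu>) *\<^sub>R T x" for x
  interpret K: compact_symmetric ip K
    unfolding K_def by (rule compact_symmetric_quadratic)
  have K: "ip (K x) x = (nrm (T x - \<mu> *\<^sub>R x))\<^sup>2 - \<mu>\<^sup>2 * ip x x" for x
    unfolding nrm_square by (simp add: K_def ip_linear T_symmetric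
        power2_eq_square algebra_simps)
  have "0 < \<epsilon> * nrm v" using v nrm_nonneg[of "T v - \<mu> *\<^sub>R v"] by linarith
  then have "0 < \<epsilon>" "0 < nrm v" using nrm_nonneg[of v] by (metis zero_less_mult_iff not_less)+
  then have vv: "0 < ip v v" by (simp add: nrm_def)
  have "(nrm (T v - \<mu> *\<^sub>R v))\<^sup>2 < (\<epsilon> * nrm v)\<^sup>2"
    using v by (intro power_strict_mono) auto
  then have lt: "ip (K v) v < (\<epsilon>\<^sup>2 - \<mu>\<^sup>2) * ip v v"
    by (simp add: K power_mult_distrib nrm_square algebra_simps)
  have "\<epsilon>\<^sup>2 \<le> \<mu>\<^sup>2" using assms(2) \<open>0 < \<epsilon>\<close> by (simp add: abs_le_square_iff[symmetric])
  then have "(\<epsilon>\<^sup>2 - \<mu>\<^sup>2) * ip v v \<le> 0" using vv by (simp add: mult_nonpos_nonneg)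
  with lt have "ip (K v) v < 0" by linarith
  then obtain \<kappa> g where \<kappa>: "\<kappa> * ip v v \<le> ip (K v) v" and g: "nrm g \<noteq> 0"
    and eig: "nrm (K g - \<kappa> *\<^sub>R g) = 0"
    by (rule K.negative_eigenvalue)
  have "\<kappa> * ip v v < (\<epsilon>\<^sup>2 - \<mu>\<^sup>2) * ip v v" using \<kappa> lt by linarith
  then have \<kappa>_lt: "\<kappa> + \<mu>\<^sup>2 < \<epsilon>\<^sup>2" using vv by simp
  have gg: "ip g g > 0" using g nrm_square[of g] by (metis zero_less_power2)
  \<comment> \<open>Pairing the eigenvalue equation of \<open>K\<close> with \<open>g\<close> makes
    \<open>\<kappa> + \<mu>\<^sup>2\<close> a quotient of squared norms, so its square root
    exists.\<close>
  have "ip (K g - \<kappa> *\<^sub>R g) g = 0" using ip_le_nrm[of "K g - \<kappa> *\<^sub>R g" g] eig by simp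
  then have "(\<kappa> + \<mu>\<^sup>2) * ip g g = (nrm (T g - \<mu> *\<^sub>R g))\<^sup>2"
    by (simp add: ip_linear K algebra_simps)
  then have "0 \<le> \<kappa> + \<mu>\<^sup>2" using gg by (metis zero_le_power2 zero_le_mult_iff not_less)
  define s where "s = sqrt (\<kappa> + \<mu>\<^sup>2)"
  have s: "0 \<le> s" "s\<^sup>2 = \<kappa> + \<mu>\<^sup>2" using \<open>0 \<le> \<kappa> + \<mu>\<^sup>2\<close> by (auto simp: s_def)
  have "s < \<epsilon>" using s \<kappa>_lt \<open>0 < \<epsilon>\<close> by (intro power_less_imp_less_base[of s 2 \<epsilon>]) auto
  \<comment> \<open>The image of \<open>g\<close> under the inner factor. If it is a null vector,
    \<open>g\<close> itself belongs to \<open>\<mu> - s\<close>; otherwise \<open>w\<close> belongs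
    to \<open>\<mu> + s\<close>.\<close>
  define w where "w = T g - (\<mu> - s) *\<^sub>R g"
  have \<kappa>_eq: "\<kappa> = s * s - \<mu> * \<mu>" using s by (simp add: power2_eq_square)
  have "T w - (\<mu> + s) *\<^sub>R w = K g - \<kappa> *\<^sub>R g"
    by (simp add: \<kappa>_eq w_def K_def T_diff T_add T_scaleR scaleR_2[symmetric] algebra_simps)
  with eig have "nrm (T w - (\<mu> + s) *\<^sub>R w) = 0" by simp
  show thesis
  proof (cases "nrm w = 0")
    case True
    with g s \<open>s < \<epsilon>\<close> show ?thesis by (intro that[of "\<mu> - s" g]) (auto simp: w_def)
  next
    case False
    with s \<open>s < \<epsilon>\<close> \<open>nrm (T w - (\<mu> + s) *\<^sub>R w) = 0\<close> show ?thesis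
      by (intro that[of "\<mu> + s" w]) auto
  qed
qed

text \<open>If \<open>T\<close> shrinks some vector \<open>T w\<close> of its range by a factor
  below \<open>\<epsilon>\<close>, the square of \<open>T\<close> has an eigenvalue strictly between
  0 and \<open>\<epsilon>\<^sup>2\<close>, and one of its square roots serves. Otherwise
  \<open>T\<close> is bounded below on its range, and a kernel vector is obtained by projecting
  \<open>v\<close>, so that 0 is an eigenvalue.\<close>

lemma eigenvalue_near_zero:
  assumes v: "nrm (T v) < \<epsilon> * nrm v"
  obtains m w where "\<bar>m\<bar> < \<epsilon>" "nrm w \<noteq> 0" "nrm (T w - m *\<^sub>R w) = 0"
proof (cases "\<exists>w. nrm (T (T w)) < \<epsilon> * nrm (T w)")
  case True
  then obtain w where w: "nrm (T (T w)) < \<epsilon> * nrm (T w)" by blast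
  have "0 < \<epsilon> * nrm (T w)" using w nrm_nonneg[of "T (T w)"] by linarith
  then have "0 < \<epsilon>" using nrm_nonneg by (metis zero_less_mult_iff not_less)
  interpret S: compact_symmetric ip "\<lambda>x. T (T x)"
    using compact_symmetric_quadratic[of 0] by simp
  have "(nrm (T (T w)))\<^sup>2 < (\<epsilon> * nrm (T w))\<^sup>2"
    using w by (intro power_strict_mono) auto
  then have lt: "ip (T (T w)) (T (T w)) < \<epsilon>\<^sup>2 * ip (T w) (T w)"
    by (simp add: power_mult_distrib nrm_square)
  \<comment> \<open>Centre and radius agree, as the nonzero case permits, and the interval is
    exactly from 0 to \<open>\<epsilon>\<^sup>2\<close>. Squaring both sides and cancelling
    \<open>(\<epsilon>\<^sup>2 / 2)\<^sup>2 * ip w w\<close> leaves the inequality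
    \<open>lt\<close>.\<close>
  have "nrm (T (T w) - (\<epsilon>\<^sup>2 / 2) *\<^sub>R w) < (\<epsilon>\<^sup>2 / 2) * nrm w"
  proof (rule power_less_imp_less_base[of _ 2])
    show "(nrm (T (T w) - (\<epsilon>\<^sup>2 / 2) *\<^sub>R w))\<^sup>2 < (\<epsilon>\<^sup>2 / 2 * nrm w)\<^sup>2"
      unfolding power_mult_distrib nrm_square using lt
      by (simp add: ip_linear T_symmetric
          power2_eq_square algebra_simps)
  qed simp
  then obtain m g where m: "\<bar>m - \<epsilon>\<^sup>2 / 2\<bar> < \<epsilon>\<^sup>2 / 2" and g: "nrm g \<noteq> 0"
    and eig: "nrm (T (T g) - m *\<^sub>R g) = 0"
    by (rule S.eigenvalue_near_nonzero) auto
  have m': "0 < m" "m < \<epsilon>\<^sup>2" using m by linarith+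
  define s where "s = sqrt m"
  have s: "0 < s" "m = s * s" using m' by (auto simp: s_def)
  have "s < \<epsilon>" using m' \<open>0 < \<epsilon>\<close> real_sqrt_less_mono[OF m'(2)] by (simp add: s_def)
  \<comment> \<open>The square of \<open>T\<close> minus \<open>m\<close> factors as
    \<open>T - s\<close> after \<open>T + s\<close>, so either \<open>g\<close> belongs to
    \<open>-s\<close> or \<open>z\<close> belongs to \<open>s\<close>.\<close>
  define z where "z = T g + s *\<^sub>R g"
  have "T z - s *\<^sub>R z = T (T g) - m *\<^sub>R g"
    by (simp add: z_def s T_add T_scaleR algebra_simps)
  with eig have "nrm (T z - s *\<^sub>R z) = 0" by simp
  show thesis
  proof (cases "nrm z = 0")
    case True
    with g s \<open>s < \<epsilon>\<close> show ?thesis by (intro that[of "- s" g]) (auto simp: z_def)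
  next
    case False
    with s \<open>s < \<epsilon>\<close> \<open>nrm (T z - s *\<^sub>R z) = 0\<close> show ?thesis by (intro that[of s z]) auto
  qed
next
  case False
  then have lower: "\<epsilon> * nrm (T w) \<le> nrm (T (T w))" for w by (auto simp: not_less)
  have "0 < \<epsilon> * nrm v" using v nrm_nonneg[of "T v"] by linarith
  then have "0 < \<epsilon>" using nrm_nonneg by (metis zero_less_mult_iff not_less)
  \<comment> \<open>The distances from \<open>v\<close> to the points of the range of the square of
    \<open>T\<close>. Their infimum \<open>d\<close> is shown to be attained at a limit of such
    points.\<close>
  define R where "R = range (\<lambda>w. nrm (v - T (T w)))"
  define d where "d = Inf R"
  have bdd: "bdd_below R" by (auto simp: R_def intro: bdd_belowI[of _ 0])
  have d_le: "d \<le> nrm (v - T (T w))" for w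
    unfolding d_def by (rule cInf_lower[OF _ bdd]) (simp add: R_def)
  have "\<exists>w. nrm (v - T (T w)) < d + 1 / real (Suc n)" for n
  proof -
    have "\<exists>z\<in>R. z < d + 1 / real (Suc n)"
      unfolding d_def by (rule cInf_lessD) (auto simp: R_def)
    then show ?thesis by (auto simp: R_def)
  qed
  then obtain w where w: "\<And>n. nrm (v - T (T (w n))) < d + 1 / real (Suc n)" by metis
  \<comment> \<open>A minimising sequence \<open>w\<close> need not be bounded, but the lower bound
    on the range makes \<open>T (w n)\<close> bounded. One more application of \<open>T\<close> then
    gives a convergent subsequence.\<close>
  have "nrm (T (w n)) \<le> (nrm v + d + 1) / \<epsilon>" for n
  proof -
    have "\<epsilon> * nrm (T (w n)) \<le> nrm (T (T (w n)))" by (rule lower)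
    also have "\<dots> \<le> nrm v + nrm (v - T (T (w n)))"
      using nrm_diff_le[of "T (T (w n))" v] nrm_minus_commute[of v] by simp
    also have "\<dots> \<le> nrm v + d + 1"
      using w[of n] by (smt (verit) divide_le_eq_1_pos of_nat_0_less_iff of_nat_Suc zero_less_Suc of_nat_0_le_iff)
    finally show ?thesis using \<open>0 < \<epsilon>\<close> by (simp add: field_simps)
  qed
  then obtain r y where r: "strict_mono r" and y: "(\<lambda>n. nrm (T (T (w (r n))) - y)) \<longlonglongrightarrow> 0"
    by (rule compact_bounded_sequence)
  define x where "x = v - y"
  have conv: "(\<lambda>n. nrm ((v - T (T (w (r n))) - z) - (x - z))) \<longlonglongrightarrow> 0" for z
    using y by (simp add: x_def nrm_minus_commute[of y])
  have "(\<lambda>n. nrm (v - T (T (w (r n))))) \<longlonglongrightarrow> nrm x"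
    using tendsto_nrm[OF conv[of 0]] by simp
  moreover have "(\<lambda>n. d + 1 / real (Suc (r n))) \<longlonglongrightarrow> d"
    using LIMSEQ_subseq_LIMSEQ[OF LIMSEQ_inverse_real_of_nat_add[of d] r]
    by (simp add: o_def inverse_eq_divide)
  ultimately have "nrm x \<le> d"
    by (rule LIMSEQ_le) (use w in \<open>auto intro: less_imp_le\<close>)
  \<comment> \<open>Subtracting \<open>T (T z)\<close> only replaces \<open>w (r n)\<close> by
    \<open>w (r n) + z\<close>, so the distance stays at least \<open>d\<close>, also in the
    limit.\<close>
  have d_le_x: "d \<le> nrm (x - T (T z))" for z
  proof (rule LIMSEQ_le_const[OF tendsto_nrm[OF conv[of "T (T z)"]]])
    show "\<exists>N. \<forall>n\<ge>N. d \<le> nrm (v - T (T (w (r n))) - T (T z))"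
      using d_le[of "w (r n) + z" for n] by (auto simp: T_add algebra_simps)
  qed
  have orth: "ip x (T (T z)) = 0" for z
  proof (rule ccontr)
    define a b where "a = ip x (T (T z))" and "b = ip (T (T z)) (T (T z))"
    assume "ip x (T (T z)) \<noteq> 0"
    then have "a \<noteq> 0" by (simp add: a_def)
    have "b \<ge> 0" by (simp add: b_def ip_nonneg)
    \<comment> \<open>Minimality at this \<open>t\<close> gives
      \<open>2 * t * a \<le> t * t * b\<close>, which is impossible for
      \<open>a = t * (b + 1)\<close> unless \<open>t = 0\<close>. The added 1 avoids division by
      zero.\<close>
    define t where "t = a / (b + 1)"
    have "nrm x \<le> nrm (x - t *\<^sub>R T (T z))"
      using \<open>nrm x \<le> d\<close> d_le_x[of "t *\<^sub>R z"] by (simp add: T_scaleR)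
    then have "(nrm x)\<^sup>2 \<le> (nrm (x - t *\<^sub>R T (T z)))\<^sup>2" by (intro power_mono) auto
    then have "2 * t * a \<le> t * t * b"
      by (simp add: nrm_square ip_linear ip_commute[of "T (T z)" x] a_def b_def algebra_simps)
    moreover have "a = t * (b + 1)" using \<open>b \<ge> 0\<close> by (simp add: t_def)
    ultimately have "t * t * (b + 2) \<le> 0" by (simp add: algebra_simps)
    moreover have "t * t * (b + 2) > 0"
      using \<open>a \<noteq> 0\<close> \<open>a = t * (b + 1)\<close> \<open>b \<ge> 0\<close> by (auto simp: zero_less_mult_iff)
    ultimately show False by simp
  qed
  \<comment> \<open>Orthogonality is tested on the fourth power of \<open>T\<close> at
    \<open>x\<close>; by symmetry this annihilates first \<open>T (T x)\<close> and then
    \<open>T x\<close>, up to null vectors.\<close>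
  have "ip (T (T x)) (T (T x)) = 0" using orth[of "T (T x)"] by (simp add: T_symmetric)
  then have "nrm (T (T x)) = 0" by (simp add: nrm_def)
  then have "ip (T x) (T x) = 0"
    using ip_le_nrm[of "T (T x)" x] by (simp add: T_symmetric)
  then have Tx: "nrm (T x - 0 *\<^sub>R x) = 0" by (simp add: nrm_def)
  \<comment> \<open>Were \<open>x\<close> null, \<open>v\<close> would be a limit of points of the
    range of \<open>T\<close> and inherit \<open>\<epsilon> * nrm v \<le> nrm (T v)\<close>.\<close>
  have "nrm x \<noteq> 0"
  proof
    assume "nrm x = 0"
    then have "(\<lambda>n. nrm (T (T (w (r n))) - v)) \<longlonglongrightarrow> 0"
      using tendsto_nrm[OF conv[of 0]] by (simp add: nrm_minus_commute[of v])
    from LIMSEQ_le[OF tendsto_mult_left[OF tendsto_nrm[OF this], of \<epsilon>]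
        tendsto_nrm[OF tendsto_T[OF this]]]
    have "\<epsilon> * nrm v \<le> nrm (T v)" using lower by auto
    with v show False by simp
  qed
  with Tx \<open>0 < \<epsilon>\<close> show thesis by (intro that[of 0 x]) auto
qed

theorem eigenvalue_near:
  assumes v: "nrm (T v - \<mu> *\<^sub>R v) < \<epsilon> * nrm v" and "\<mu> \<noteq> 0 \<Longrightarrow> \<epsilon> \<le> \<bar>\<mu>\<bar>"
  obtains m w where "\<bar>m - \<mu>\<bar> < \<epsilon>" "nrm w \<noteq> 0" "nrm (T w - m *\<^sub>R w) = 0"
proof (cases "\<mu> = 0")
  case True
  with v show thesis using eigenvalue_near_zero[of v \<epsilon>] that by auto
next
  case False
  with assms show thesis using eigenvalue_near_nonzero[of v \<mu> \<epsilon>] that by auto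
qed

end

section \<open>Square-integrable functions\<close>

lemma integrable_mult_square_integrable:
  fixes f g :: "'b \<Rightarrow> real"
  assumes [measurable]: "f \<in> borel_measurable M" "g \<in> borel_measurable M"
    and "integrable M (\<lambda>x. (f x)\<^sup>2)" "integrable M (\<lambda>x. (g x)\<^sup>2)"
  shows "integrable M (\<lambda>x. f x * g x)"
proof (rule Bochner_Integration.integrable_bound[OF Bochner_Integration.integrable_add[OF assms(3,4)]])
  have "\<bar>a * b\<bar> \<le> a\<^sup>2 + b\<^sup>2" for a b :: real
  proof -
    have "0 \<le> \<bar>a\<bar> * \<bar>b\<bar>" by simp
    moreover have "2 * (\<bar>a\<bar> * \<bar>b\<bar>) \<le> a\<^sup>2 + b\<^sup>2"
      using sum_squares_bound[of "\<bar>a\<bar>" "\<bar>b\<bar>"] by (simp add: mult.assoc)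
    ultimately show ?thesis by (simp only: abs_mult)
  qed
  then show "AE x in M. norm (f x * g x) \<le> norm ((f x)\<^sup>2 + (g x)\<^sup>2)"
    by (intro AE_I2) (simp add: abs_mult)
qed measurable

lemma square_integrable_add:
  fixes f g :: "'b \<Rightarrow> real"
  assumes "f \<in> borel_measurable M" "g \<in> borel_measurable M"
    and "integrable M (\<lambda>x. (f x)\<^sup>2)" "integrable M (\<lambda>x. (g x)\<^sup>2)"
  shows "integrable M (\<lambda>x. (f x + g x)\<^sup>2)"
  unfolding power2_sum mult.assoc
  by (intro Bochner_Integration.integrable_add integrable_mult_right assms
      integrable_mult_square_integrable)

lemma (in finite_measure) integrable_square_integrable:
  fixes f :: "'a \<Rightarrow> real"
  assumes "f \<in> borel_measurable M" "integrable M (\<lambda>x. (f x)\<^sup>2)"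
  shows "integrable M f"
  using integrable_mult_square_integrable[of f M "\<lambda>_. 1"] assms by simp

text \<open>Cauchy-Schwarz for \<open>\<bar>f\<bar>\<close> against the constant 1, from the
  nonnegative integral of \<open>(t * \<bar>f x\<bar> - 1)\<^sup>2\<close>.\<close>

lemma (in finite_measure) integral_abs_square_le:
  fixes f :: "'a \<Rightarrow> real"
  assumes f: "f \<in> borel_measurable M" "integrable M (\<lambda>x. (f x)\<^sup>2)"
  shows "(\<integral>x. \<bar>f x\<bar> \<partial>M)\<^sup>2 \<le> measure M (space M) * (\<integral>x. (f x)\<^sup>2 \<partial>M)"
proof -
  define a m where "a = (\<integral>x. \<bar>f x\<bar> \<partial>M)" and "m = measure M (space M)"
  have int: "integrable M (\<lambda>x. \<bar>f x\<bar>)" using integrable_square_integrable[OF f] by simp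
  have q: "0 \<le> t\<^sup>2 * (\<integral>x. (f x)\<^sup>2 \<partial>M) - 2 * t * a + m" for t
  proof -
    have "0 \<le> (\<integral>x. (t * \<bar>f x\<bar> - 1)\<^sup>2 \<partial>M)" by (rule integral_nonneg_AE) simp
    also have "\<dots> = (\<integral>x. t\<^sup>2 * (f x)\<^sup>2 - 2 * t * \<bar>f x\<bar> + 1 \<partial>M)"
      by (simp add: power2_diff power_mult_distrib algebra_simps)
    also have "\<dots> = t\<^sup>2 * (\<integral>x. (f x)\<^sup>2 \<partial>M) - 2 * t * a + m"
      using int f(2) by (simp add: a_def m_def)
    finally show ?thesis .
  qed
  let ?s = "\<integral>x. (f x)\<^sup>2 \<partial>M"
  have "0 \<le> ?s" by (rule integral_nonneg_AE) simp
  show ?thesis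
  proof (cases "?s = 0")
    case True
    have "a = 0"
    proof (rule ccontr)
      assume "a \<noteq> 0"
      then show False using q[of "(m + 1) / (2 * a)"] True by simp
    qed
    then show ?thesis by (simp add: True a_def)
  next
    case False
    with \<open>0 \<le> ?s\<close> have pos: "0 < ?s" by linarith
    have "0 \<le> m - a\<^sup>2 / ?s"
      using q[of "a / ?s"] False by (simp add: power_divide power2_eq_square[of ?s]) (simp add: power2_eq_square)
    then show ?thesis using pos by (simp add: a_def m_def field_simps)
  qed
qed

text \<open>Absolute continuity of the integral: truncate \<open>f\<close> at a level
  \<open>k\<close>. The remainder has a small integral over the whole space by dominated
  convergence, and the truncated part contributes at most \<open>k\<close> times the measure of
  \<open>A n\<close>.\<close>

lemma set_integral_tendsto_0:
  fixes f :: "'b \<Rightarrow> real"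
  assumes f: "integrable M f" "\<And>x. 0 \<le> f x"
    and A: "\<And>n. A n \<in> fmeasurable M" "(\<lambda>n. measure M (A n)) \<longlonglongrightarrow> 0"
  shows "(\<lambda>n. LINT x:A n|M. f x) \<longlonglongrightarrow> 0"
proof (rule LIMSEQ_I)
  fix e :: real assume "0 < e"
  have [measurable]: "f \<in> borel_measurable M" using f(1) by simp
  have A' [measurable]: "A n \<in> sets M" for n using A(1) by (rule fmeasurableD)
  have lim: "(\<lambda>k. \<integral>x. f x - min (f x) (real k) \<partial>M) \<longlonglongrightarrow> (\<integral>x. 0 \<partial>M)"
  proof (rule integral_dominated_convergence)
    show "AE x in M. (\<lambda>k. f x - min (f x) (real k)) \<longlonglongrightarrow> 0"
    proof (intro AE_I2 tendsto_eventually)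
      fix x
      show "\<forall>\<^sub>F k in sequentially. f x - min (f x) (real k) = 0"
        using eventually_ge_at_top[of "nat \<lceil>f x\<rceil>"] by eventually_elim (auto simp: min_def nat_le_iff ceiling_le_iff)
    qed
    show "AE x in M. norm (f x - min (f x) (real k)) \<le> f x" for k
      using f(2) by (intro AE_I2) (auto simp: min_def)
  qed (use f(1) in measurable)
  obtain k where k: "(\<integral>x. f x - min (f x) (real k) \<partial>M) < e / 2"
    using order_tendstoD(2)[OF lim, of "e / 2"] \<open>0 < e\<close>
    by (auto dest: eventually_happens)
  have i1: "integrable M (\<lambda>x. f x - min (f x) (real k))"
    by (rule Bochner_Integration.integrable_bound[OF f(1)]) (use f(2) in auto)
  have bound: "(LINT x:A n|M. f x) \<le> e / 2 + real k * measure M (A n)" for n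
  proof -
    have i2: "integrable M (\<lambda>x. real k * indicator (A n) x)"
      using A(1)[of n] by (simp add: fmeasurable_def)
    have "(LINT x:A n|M. f x)
        \<le> (\<integral>x. (f x - min (f x) (real k)) + real k * indicator (A n) x \<partial>M)"
      unfolding set_lebesgue_integral_def
      by (rule integral_mono)
         (use f(2) in \<open>auto intro!: integrable_mult_indicator[where 'b = real, simplified] f(1) Bochner_Integration.integrable_add i1 i2
            split: split_indicator\<close>)
    also have "\<dots> = (\<integral>x. f x - min (f x) (real k) \<partial>M) + real k * measure M (A n)"
      using i1 i2 by (subst Bochner_Integration.integral_add) (auto simp: measure_def)
    finally show ?thesis using k by linarith
  qed
  have "(\<lambda>n. real k * measure M (A n)) \<longlonglongrightarrow> 0" using tendsto_mult_left[OF A(2), of "real k"] by simp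
  from order_tendstoD(2)[OF this, of "e / 2"] \<open>0 < e\<close>
  obtain N where N: "\<And>n. n \<ge> N \<Longrightarrow> real k * measure M (A n) < e / 2"
    by (auto simp: eventually_sequentially)
  have "0 \<le> (LINT x:A n|M. f x)" for n
    unfolding set_lebesgue_integral_def by (rule integral_nonneg_AE) (simp add: f(2))
  then show "\<exists>N. \<forall>n\<ge>N. norm ((LINT x:A n|M. f x) - 0) < e"
    using bound N by (intro exI[of _ N]) (fastforce intro: order.strict_trans1)
qed

text \<open>
  Functions are not identified almost everywhere, and one type serves all domains \<open>U\<close>: restricting
  the integral to \<open>U\<close> gives a semi-inner product whose null vectors vanish almost everywhere on \<open>U\<close>.
\<close>

typedef (overloaded) 'a sqint = "{f :: 'a::euclidean_space \<Rightarrow> real.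
    f \<in> borel_measurable lebesgue \<and> integrable lebesgue (\<lambda>x. (f x)\<^sup>2)}"
  morphisms sqfun Abs_sqint
  by (rule exI[of _ "\<lambda>_. 0"]) simp

setup_lifting type_definition_sqint

instantiation sqint :: (euclidean_space) real_vector
begin

lift_definition zero_sqint :: "'a sqint" is "\<lambda>_. 0" by simp
lift_definition plus_sqint :: "'a sqint \<Rightarrow> 'a sqint \<Rightarrow> 'a sqint" is "\<lambda>f g x. f x + g x"
  by (auto simp: square_integrable_add)
lift_definition scaleR_sqint :: "real \<Rightarrow> 'a sqint \<Rightarrow> 'a sqint" is "\<lambda>c f x. c * f x"
  by (auto simp: power_mult_distrib)
lift_definition uminus_sqint :: "'a sqint \<Rightarrow> 'a sqint" is "\<lambda>f x. - f x"
  by simp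
lift_definition minus_sqint :: "'a sqint \<Rightarrow> 'a sqint \<Rightarrow> 'a sqint" is "\<lambda>f g x. f x - g x"
  subgoal for f g
    using square_integrable_add[of f lebesgue "\<lambda>x. - g x"] by auto
  done

instance
  by (standard; transfer) (auto simp: algebra_simps fun_eq_iff)

end

section \<open>Convolution operators on bounded domains\<close>

lemma sqfun_borel_measurable [measurable]: "sqfun f \<in> borel_measurable lebesgue"
  using sqfun[of f] by simp

lemma integrable_sqfun_square: "integrable lebesgue (\<lambda>x. (sqfun f x)\<^sup>2)"
  using sqfun[of f] by simp

locale convolution_kernel =
  fixes J :: "'a::euclidean_space \<Rightarrow> real" and U :: "'a set"
  assumes J: "hypH J" and U: "open U" "bounded U"
begin

abbreviation M :: "'a measure" where
  "M \<equiv> lebesgue_on U"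

lemma J_continuous: "continuous_on UNIV J"
  using J unfolding hypH_def by (elim conjE)

lemma J_nonneg: "0 \<le> J x"
  using J unfolding hypH_def by (elim conjE) (erule spec)

lemma J_le: "J x \<le> J 0"
proof -
  have "\<forall>x y. norm x \<le> norm y \<longrightarrow> J y \<le> J x"
    using J unfolding hypH_def by (elim conjE)
  from this[rule_format, of 0 x] show ?thesis by simp
qed

lemma J_minus_commute: "J (x - y) = J (y - x)"
proof -
  have "\<forall>x y. norm x = norm y \<longrightarrow> J x = J y"
    using J unfolding hypH_def by (elim conjE)
  from this[rule_format, OF norm_minus_commute] show ?thesis .
qed

lemma J_borel_measurable [measurable]: "J \<in> borel_measurable borel"
  using J_continuous by (rule borel_measurable_continuous_onI)

lemma U_lmeasurable: "U \<in> lmeasurable"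
  using U by (simp add: bounded_set_imp_lmeasurable borel_open)

lemma U_sets [measurable]: "U \<in> sets lebesgue"
  using U_lmeasurable by (rule fmeasurableD)

sublocale M: finite_measure M
  by (rule finite_measure_lebesgue_on[OF U_lmeasurable])

lemma borel_measurable_M: "f \<in> borel_measurable lebesgue \<Longrightarrow> f \<in> borel_measurable M"
  by (rule measurable_restrict_space1)

lemma sqfun_M [measurable]: "sqfun f \<in> borel_measurable M"
  by (rule borel_measurable_M) simp

lemma id_M [measurable]: "(\<lambda>x. x) \<in> measurable M borel"
  using id_borel_measurable_lebesgue_on[of U] by (simp add: id_def)

lemma integrable_M:
  fixes f :: "'a \<Rightarrow> real"
  assumes "integrable lebesgue f"
  shows "integrable M f"
  using integrable_mult_indicator[OF U_sets assms] by (subst integrable_restrict_space) auto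

lemma integrable_sqfun_mult: "integrable M (\<lambda>x. sqfun f x * sqfun g x)"
  by (rule integrable_M) (simp add: integrable_mult_square_integrable integrable_sqfun_square)

lemma integrable_sqfun_square_M: "integrable M (\<lambda>x. (sqfun f x)\<^sup>2)"
  by (rule integrable_M[OF integrable_sqfun_square])

lemma integrable_sqfun: "integrable M (sqfun f)"
  by (rule M.integrable_square_integrable[OF sqfun_M integrable_sqfun_square_M])

lemma integrable_J_mult: "integrable M (\<lambda>y. J (x - y) * sqfun f y)"
proof (rule Bochner_Integration.integrable_bound)
  show "integrable M (\<lambda>y. J 0 * sqfun f y)" using integrable_sqfun by simp
  show "AE y in M. norm (J (x - y) * sqfun f y) \<le> norm (J 0 * sqfun f y)"
    using J_nonneg J_le by (auto simp: abs_mult intro!: mult_right_mono)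
qed measurable

lemma integrable_J_mult_abs: "integrable M (\<lambda>y. J (x - y) * \<bar>sqfun f y\<bar>)"
  using integrable_abs[OF integrable_J_mult[of x f]] by (simp add: abs_mult J_nonneg)

section \<open>The convolution operator and its equicontinuity\<close>

definition convol :: "'a sqint \<Rightarrow> 'a \<Rightarrow> real" where
  "convol f x = (\<integral>y. J (x - y) * sqfun f y \<partial>M)"

definition ip :: "'a sqint \<Rightarrow> 'a sqint \<Rightarrow> real" where
  "ip f g = (\<integral>x. sqfun f x * sqfun g x \<partial>M)"

text \<open>Cutting off outside \<open>U\<close> makes the result square-integrable on the whole
  space, since \<open>convol f\<close> is continuous on the compact closure of
  \<open>U\<close>.\<close>

definition T :: "'a sqint \<Rightarrow> 'a sqint" where
  "T f = Abs_sqint (\<lambda>x. if x \<in> U then convol f x else 0)"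

lemma abs_convol_le: "\<bar>convol f x\<bar> \<le> J 0 * (\<integral>y. \<bar>sqfun f y\<bar> \<partial>M)"
proof -
  have "\<bar>convol f x\<bar> \<le> (\<integral>y. \<bar>J (x - y) * sqfun f y\<bar> \<partial>M)"
    unfolding convol_def by (rule integral_abs_bound)
  also have "\<dots> \<le> (\<integral>y. J 0 * \<bar>sqfun f y\<bar> \<partial>M)"
    using integrable_J_mult_abs integrable_sqfun J_nonneg J_le
    by (intro integral_mono) (auto simp: abs_mult intro!: mult_right_mono)
  finally show ?thesis by simp
qed

text \<open>All differences of points of the closure lie in a compact set, on which \<open>J\<close>
  is uniformly continuous; hence \<open>d\<close> is independent of \<open>f\<close>. The closure is
  used because Arzela-Ascoli needs a compact domain.\<close>

lemma convol_equicontinuous: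
  assumes "0 < e"
  obtains d where "0 < d" "\<And>x x' f. \<lbrakk>x \<in> closure U; x' \<in> closure U; dist x x' < d\<rbrakk> \<Longrightarrow>
    \<bar>convol f x - convol f x'\<bar> \<le> e * (\<integral>y. \<bar>sqfun f y\<bar> \<partial>M)"
proof -
  define K where "K = {x - y |x y. x \<in> closure U \<and> y \<in> closure U}"
  have "compact K" unfolding K_def by (rule compact_differences) (use U in simp_all)
  then have "uniformly_continuous_on K J"
    by (intro compact_uniformly_continuous continuous_on_subset[OF J_continuous]) auto
  then obtain d where d: "0 < d"
    "\<And>z z'. \<lbrakk>z \<in> K; z' \<in> K; dist z' z < d\<rbrakk> \<Longrightarrow> dist (J z') (J z) < e"
    using \<open>0 < e\<close> unfolding uniformly_continuous_on_def by metis
  show thesis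
  proof (rule that[OF d(1)])
    fix x x' f assume x: "x \<in> closure U" "x' \<in> closure U" "dist x x' < d"
    have J_diff: "\<bar>J (x - y) - J (x' - y)\<bar> \<le> e" if "y \<in> U" for y
    proof -
      have "y \<in> closure U" using that closure_subset by blast
      then have "dist (J (x - y)) (J (x' - y)) < e"
        using x by (intro d(2)) (auto simp: K_def dist_norm)
      then show ?thesis by (simp add: dist_real_def)
    qed
    have int: "integrable M (\<lambda>y. J (x - y) * sqfun f y - J (x' - y) * sqfun f y)"
      by (intro Bochner_Integration.integrable_diff integrable_J_mult)
    have "\<bar>convol f x - convol f x'\<bar> = \<bar>\<integral>y. J (x - y) * sqfun f y - J (x' - y) * sqfun f y \<partial>M\<bar>"
      unfolding convol_def by (subst Bochner_Integration.integral_diff) (simp_all add: integrable_J_mult)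
    also have "\<dots> \<le> (\<integral>y. \<bar>J (x - y) * sqfun f y - J (x' - y) * sqfun f y\<bar> \<partial>M)"
      by (rule integral_abs_bound)
    also have "\<dots> \<le> (\<integral>y. e * \<bar>sqfun f y\<bar> \<partial>M)"
    proof (rule integral_mono)
      show "integrable M (\<lambda>y. \<bar>J (x - y) * sqfun f y - J (x' - y) * sqfun f y\<bar>)"
        using int by simp
      show "integrable M (\<lambda>y. e * \<bar>sqfun f y\<bar>)" using integrable_sqfun by simp
      fix y assume "y \<in> space M"
      then show "\<bar>J (x - y) * sqfun f y - J (x' - y) * sqfun f y\<bar> \<le> e * \<bar>sqfun f y\<bar>"
        using J_diff[of y] by (simp add: abs_mult mult_right_mono flip: left_diff_distrib)
    qed
    finally show "\<bar>convol f x - convol f x'\<bar> \<le> e * (\<integral>y. \<bar>sqfun f y\<bar> \<partial>M)" by simp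
  qed
qed

lemma continuous_on_convol: "continuous_on (closure U) (convol f)"
proof (rule continuous_onI)
  fix x and e :: real assume "x \<in> closure U" "0 < e"
  define a where "a = (\<integral>y. \<bar>sqfun f y\<bar> \<partial>M)"
  have "0 \<le> a" unfolding a_def by (rule integral_nonneg_AE) simp
  have "0 < e / (a + 1)" using \<open>0 \<le> a\<close> \<open>0 < e\<close> by simp
  then obtain d where d: "0 < d" "\<And>x x' f. \<lbrakk>x \<in> closure U; x' \<in> closure U; dist x x' < d\<rbrakk> \<Longrightarrow>
    \<bar>convol f x - convol f x'\<bar> \<le> e / (a + 1) * (\<integral>y. \<bar>sqfun f y\<bar> \<partial>M)"
    by (rule convol_equicontinuous) blast
  have "e / (a + 1) * a \<le> e" using \<open>0 \<le> a\<close> \<open>0 < e\<close> by (simp add: field_simps)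
  then have "dist (convol f x') (convol f x) \<le> e" if "x' \<in> closure U" "dist x' x < d" for x'
    using d(2)[OF that(1) \<open>x \<in> closure U\<close> that(2), of f] unfolding dist_real_def a_def by linarith
  then show "\<exists>d>0. \<forall>x'\<in>closure U. dist x' x < d \<longrightarrow> dist (convol f x') (convol f x) \<le> e"
    using d(1) by blast
qed

lemma restricted_continuous_square_integrable:
  fixes h :: "'a \<Rightarrow> real"
  assumes "continuous_on (closure U) h"
  shows "(\<lambda>x. if x \<in> U then h x else 0) \<in> borel_measurable lebesgue"
    and "integrable lebesgue (\<lambda>x. (if x \<in> U then h x else 0)\<^sup>2)"
proof -
  have "continuous_on U h" using assms closure_subset continuous_on_subset by blast
  then have "h \<in> borel_measurable M" by (rule continuous_imp_measurable_on_sets_lebesgue) simp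
  then show meas: "(\<lambda>x. if x \<in> U then h x else 0) \<in> borel_measurable lebesgue"
    by (rule borel_measurable_if_I) simp
  have "compact (h ` closure U)"
    by (rule compact_continuous_image[OF assms]) (use U in simp)
  then obtain B where B: "\<And>x. x \<in> closure U \<Longrightarrow> \<bar>h x\<bar> \<le> B"
    by (force dest!: compact_imp_bounded simp: bounded_iff)
  show "integrable lebesgue (\<lambda>x. (if x \<in> U then h x else 0)\<^sup>2)"
  proof (rule Bochner_Integration.integrable_bound)
    show "integrable lebesgue (\<lambda>x. B\<^sup>2 * indicator U x)"
      using U_lmeasurable by (simp add: fmeasurable_def)
    show "AE x in lebesgue. norm ((if x \<in> U then h x else 0)\<^sup>2) \<le> norm (B\<^sup>2 * indicator U x)"
    proof (rule AE_I2)
      fix x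
      show "norm ((if x \<in> U then h x else 0)\<^sup>2) \<le> norm (B\<^sup>2 * indicator U x)"
      proof (cases "x \<in> U")
        case True
        then have "x \<in> closure U" using closure_subset by blast
        from power_mono[OF B[OF this], of 2] True show ?thesis by simp
      qed simp
    qed
  qed (use meas in measurable)
qed

lemma sqfun_Abs_sqint_restricted:
  assumes "continuous_on (closure U) h"
  shows "sqfun (Abs_sqint (\<lambda>x. if x \<in> U then h x else 0)) = (\<lambda>x. if x \<in> U then h x else 0)"
  using restricted_continuous_square_integrable[OF assms] by (simp add: Abs_sqint_inverse)

lemma sqfun_T: "sqfun (T f) = (\<lambda>x. if x \<in> U then convol f x else 0)"
  unfolding T_def by (rule sqfun_Abs_sqint_restricted[OF continuous_on_convol])

section \<open>The seminorm of square-integrable functions on a domain\<close>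

sublocale semi_inner_product ip
proof
  fix x y z :: "'a sqint" and c :: real
  show "ip x y = ip y x" by (simp add: ip_def mult.commute)
  show "ip (x + y) z = ip x z + ip y z"
    using Bochner_Integration.integral_add[OF integrable_sqfun_mult integrable_sqfun_mult]
    by (simp add: ip_def plus_sqint.rep_eq distrib_right)
  show "ip (c *\<^sub>R x) z = c * ip x z" by (simp add: ip_def scaleR_sqint.rep_eq mult.assoc)
  show "0 \<le> ip x x" unfolding ip_def by (rule integral_nonneg_AE) simp
qed

lemma nrm_square_integral: "(nrm f)\<^sup>2 = (\<integral>x. (sqfun f x)\<^sup>2 \<partial>M)"
  unfolding nrm_square ip_def by (simp add: power2_eq_square)

lemma nrm_eq_0_iff: "nrm f = 0 \<longleftrightarrow> (AE x in lebesgue. x \<in> U \<longrightarrow> sqfun f x = 0)"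
proof -
  have "nrm f = 0 \<longleftrightarrow> (\<integral>x. (sqfun f x)\<^sup>2 \<partial>M) = 0"
    by (simp flip: nrm_square_integral)
  also have "\<dots> \<longleftrightarrow> (AE x in M. (sqfun f x)\<^sup>2 = 0)"
    by (rule integral_nonneg_eq_0_iff_AE[OF integrable_sqfun_square_M]) simp
  also have "\<dots> \<longleftrightarrow> (AE x in lebesgue. x \<in> U \<longrightarrow> sqfun f x = 0)"
    by (subst AE_restrict_space_iff) auto
  finally show ?thesis .
qed

lemma integral_abs_le_nrm:
  "(\<integral>y. \<bar>sqfun f y\<bar> \<partial>M) \<le> sqrt (measure lebesgue U) * nrm f"
proof (rule power2_le_imp_le)
  show "(\<integral>y. \<bar>sqfun f y\<bar> \<partial>M)\<^sup>2 \<le> (sqrt (measure lebesgue U) * nrm f)\<^sup>2"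
    using M.integral_abs_square_le[OF sqfun_M integrable_sqfun_square_M, of f]
    by (simp add: power_mult_distrib nrm_square_integral measure_restrict_space)
qed simp

text \<open>Since \<open>U\<close> has finite measure, uniform estimates give seminorm estimates;
  this carries the uniform limits of Arzela-Ascoli over to \<open>nrm\<close>.\<close>

lemma nrm_le_sup:
  assumes "\<And>x. x \<in> U \<Longrightarrow> \<bar>sqfun f x\<bar> \<le> B" "0 \<le> B"
  shows "nrm f \<le> sqrt (measure lebesgue U) * B"
proof (rule power2_le_imp_le)
  have "(nrm f)\<^sup>2 \<le> (\<integral>x. B\<^sup>2 \<partial>M)"
    unfolding nrm_square_integral
  proof (rule integral_mono[OF integrable_sqfun_square_M])
    fix x assume "x \<in> space M"
    then have "\<bar>sqfun f x\<bar> \<le> B" using assms(1) by simp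
    from power_mono[OF this, of 2] show "(sqfun f x)\<^sup>2 \<le> B\<^sup>2" by simp
  qed simp
  then show "(nrm f)\<^sup>2 \<le> (sqrt (measure lebesgue U) * B)\<^sup>2"
    by (simp add: power_mult_distrib measure_restrict_space mult.commute)
qed (simp add: assms(2))

section \<open>Symmetry and compactness of the convolution operator\<close>

lemma T_symmetric: "ip (T f) g = ip f (T g)"
proof -
  interpret P: pair_sigma_finite M M
    by (intro pair_sigma_finite.intro M.sigma_finite_measure_axioms)
  let ?k = "\<lambda>x y. J (x - y) * sqfun f y * sqfun g x"
  \<comment> \<open>Fubini applies because \<open>J\<close> is at most \<open>J 0\<close>, which
    bounds the kernel by a product of integrable functions; symmetry of \<open>T\<close> is then
    that of \<open>J (x - y)\<close>.\<close>
  have int: "integrable (M \<Otimes>\<^sub>M M) (case_prod ?k)"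
  proof (rule P.Fubini_integrable)
    show meas [measurable]: "case_prod ?k \<in> borel_measurable (M \<Otimes>\<^sub>M M)"
      by measurable
    have [measurable]: "(\<lambda>x. \<integral>y. norm (case_prod ?k (x, y)) \<partial>M) \<in> borel_measurable M"
      by measurable
    let ?a = "J 0 * (\<integral>y. \<bar>sqfun f y\<bar> \<partial>M)"
    show "integrable M (\<lambda>x. \<integral>y. norm (case_prod ?k (x, y)) \<partial>M)"
    proof (rule Bochner_Integration.integrable_bound)
      show "integrable M (\<lambda>x. ?a * sqfun g x)" using integrable_sqfun by simp
      show "AE x in M. norm (\<integral>y. norm (case_prod ?k (x, y)) \<partial>M) \<le> norm (?a * sqfun g x)"
      proof (rule AE_I2)
        fix x
        have "norm (\<integral>y. norm (case_prod ?k (x, y)) \<partial>M) = (\<integral>y. norm (case_prod ?k (x, y)) \<partial>M)"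
          by (simp add: integral_nonneg_AE)
        also have "\<dots> \<le> (\<integral>y. J 0 * \<bar>sqfun f y\<bar> * \<bar>sqfun g x\<bar> \<partial>M)"
          using integrable_J_mult_abs integrable_sqfun J_nonneg J_le
          by (intro integral_mono) (auto simp: abs_mult intro!: mult_right_mono)
        also have "\<dots> = ?a * \<bar>sqfun g x\<bar>" by simp
        also have "\<dots> \<le> norm (?a * sqfun g x)"
          by (simp add: abs_mult mult_right_mono)
        finally show "norm (\<integral>y. norm (case_prod ?k (x, y)) \<partial>M) \<le> norm (?a * sqfun g x)" .
      qed
    qed measurable
    show "AE x in M. integrable M (\<lambda>y. case_prod ?k (x, y))"
      using integrable_J_mult by simp
  qed
  have "ip (T f) g = (\<integral>x. (\<integral>y. ?k x y \<partial>M) \<partial>M)"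
    unfolding ip_def sqfun_T
    by (intro Bochner_Integration.integral_cong) (auto simp: convol_def)
  also have "\<dots> = (\<integral>y. (\<integral>x. ?k x y \<partial>M) \<partial>M)"
    using P.Fubini_integral[OF int] by simp
  also have "\<dots> = ip f (T g)"
    unfolding ip_def sqfun_T
  proof (intro Bochner_Integration.integral_cong refl)
    fix y assume "y \<in> space M"
    have "(\<integral>x. ?k x y \<partial>M) = (\<integral>x. sqfun f y * (J (y - x) * sqfun g x) \<partial>M)"
      by (intro Bochner_Integration.integral_cong) (simp_all add: J_minus_commute[of y])
    also have "\<dots> = sqfun f y * (if y \<in> U then convol g y else 0)"
      using \<open>y \<in> space M\<close> by (simp add: convol_def)
    finally show "(\<integral>x. ?k x y \<partial>M) = sqfun f y * (if y \<in> U then convol g y else 0)" .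
  qed
  finally show ?thesis .
qed

text \<open>On the unit ball the integrals of \<open>\<bar>v n\<bar>\<close> are bounded by
  \<open>s\<close>, so the convolutions are uniformly bounded and equicontinuous. Arzela-Ascoli
  gives a uniformly convergent subsequence, whose limit cut off to \<open>U\<close> is
  \<open>g\<close>.\<close>

lemma T_compact:
  fixes v :: "nat \<Rightarrow> 'a sqint"
  assumes v: "\<And>n. nrm (v n) \<le> 1"
  shows "\<exists>r g. strict_mono r \<and> (\<lambda>n. nrm (T (v (r n)) - g)) \<longlonglongrightarrow> 0"
proof -
  define s where "s = sqrt (measure lebesgue U)"
  have "0 \<le> s" by (simp add: s_def)
  have a: "(\<integral>y. \<bar>sqfun (v n) y\<bar> \<partial>M) \<le> s" for n
    using integral_abs_le_nrm[of "v n"] mult_left_mono[OF v[of n] \<open>0 \<le> s\<close>] by (simp add: s_def)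
  obtain h r where h: "continuous_on (closure U) h" and r: "strict_mono (r :: nat \<Rightarrow> nat)"
    and lim: "\<And>e. 0 < e \<Longrightarrow>
      \<exists>N. \<forall>n x. n \<ge> N \<and> x \<in> closure U \<longrightarrow> norm (convol (v (r n)) x - h x) < e"
  proof (rule Arzela_Ascoli[of "closure U" "\<lambda>n. convol (v n)" "J 0 * s"])
    show "compact (closure U)" using U by simp
    show "norm (convol (v n) x) \<le> J 0 * s" for n x
      using abs_convol_le[of "v n" x] mult_left_mono[OF a[of n] J_nonneg[of 0]] by simp
    show "\<exists>d>0. \<forall>n y. y \<in> closure U \<and> norm (x - y) < d \<longrightarrow>
        norm (convol (v n) x - convol (v n) y) < e"
      if "x \<in> closure U" "0 < e" for x e
    proof -
      \<comment> \<open>Dividing by \<open>s + 1\<close> covers \<open>s = 0\<close> and makes the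
        final estimate strict, as Arzela-Ascoli asks.\<close>
      have "0 < e / (s + 1)" using \<open>0 \<le> s\<close> \<open>0 < e\<close> by simp
      then obtain d where d: "0 < d"
        "\<And>x x' f. \<lbrakk>x \<in> closure U; x' \<in> closure U; dist x x' < d\<rbrakk> \<Longrightarrow>
          \<bar>convol f x - convol f x'\<bar> \<le> e / (s + 1) * (\<integral>y. \<bar>sqfun f y\<bar> \<partial>M)"
        by (rule convol_equicontinuous) blast
      have "e / (s + 1) * (\<integral>y. \<bar>sqfun (v n) y\<bar> \<partial>M) \<le> e / (s + 1) * s" for n
        using a \<open>0 < e / (s + 1)\<close> by (intro mult_left_mono) auto
      moreover have "e / (s + 1) * s < e" using \<open>0 \<le> s\<close> \<open>0 < e\<close> by (simp add: field_simps)
      ultimately have "e / (s + 1) * (\<integral>y. \<bar>sqfun (v n) y\<bar> \<partial>M) < e" for n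
        by (rule order.strict_trans1)
      then have "norm (convol (v n) x - convol (v n) y) < e"
        if "y \<in> closure U \<and> norm (x - y) < d" for n y
        using d(2)[OF \<open>x \<in> closure U\<close>, of y "v n"] that
        unfolding dist_norm real_norm_def by (meson order.strict_trans1)
      then show ?thesis using d(1) by blast
    qed
  qed blast
  define g where "g = Abs_sqint (\<lambda>x. if x \<in> U then h x else 0)"
  have g: "sqfun g = (\<lambda>x. if x \<in> U then h x else 0)"
    unfolding g_def by (rule sqfun_Abs_sqint_restricted[OF h])
  have "(\<lambda>n. nrm (T (v (r n)) - g)) \<longlonglongrightarrow> 0"
  proof (rule LIMSEQ_I)
    fix e :: real assume "0 < e"
    have "0 < e / (s + 1)" using \<open>0 \<le> s\<close> \<open>0 < e\<close> by simp
    from lim[OF this] obtain N where N: "\<And>n x. \<lbrakk>n \<ge> N; x \<in> closure U\<rbrakk> \<Longrightarrow>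
      norm (convol (v (r n)) x - h x) < e / (s + 1)" by blast
    have "nrm (T (v (r n)) - g) < e" if "n \<ge> N" for n
    proof -
      have "nrm (T (v (r n)) - g) \<le> s * (e / (s + 1))"
        unfolding s_def
      proof (rule nrm_le_sup)
        fix x assume "x \<in> U"
        moreover from this have "x \<in> closure U" using closure_subset by blast
        ultimately show "\<bar>sqfun (T (v (r n)) - g) x\<bar> \<le> e / (sqrt (measure lebesgue U) + 1)"
          using N[OF that, of x] by (simp add: minus_sqint.rep_eq sqfun_T g s_def)
      qed (use \<open>0 < e / (s + 1)\<close> in \<open>simp add: s_def\<close>)
      also have "\<dots> < e" using \<open>0 \<le> s\<close> \<open>0 < e\<close> by (simp add: field_simps)
      finally show ?thesis .
    qed
    then show "\<exists>N. \<forall>n\<ge>N. norm (nrm (T (v (r n)) - g) - 0) < e" by auto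
  qed
  with r show ?thesis by blast
qed

sublocale compact_symmetric ip T
proof
  show "T (x + y) = T x + T y" for x y
  proof -
    have "convol (x + y) z = convol x z + convol y z" for z
      unfolding convol_def plus_sqint.rep_eq distrib_left
      by (intro Bochner_Integration.integral_add integrable_J_mult)
    then show ?thesis
      by (intro sqfun_inject[THEN iffD1]) (auto simp: sqfun_T plus_sqint.rep_eq fun_eq_iff)
  qed
  show "T (c *\<^sub>R x) = c *\<^sub>R T x" for c x
  proof -
    have "convol (c *\<^sub>R x) z = c * convol x z" for z
      by (simp add: convol_def scaleR_sqint.rep_eq mult.left_commute[of _ c])
    then show ?thesis
      by (intro sqfun_inject[THEN iffD1]) (auto simp: sqfun_T scaleR_sqint.rep_eq fun_eq_iff)
  qed
  show "\<exists>C. \<forall>x. nrm (T x) \<le> C * nrm x"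
  proof (intro exI allI)
    fix f
    let ?s = "sqrt (measure lebesgue U)"
    have "nrm (T f) \<le> ?s * (J 0 * (?s * nrm f))"
    proof (rule nrm_le_sup)
      fix x assume "x \<in> U"
      then show "\<bar>sqfun (T f) x\<bar> \<le> J 0 * (?s * nrm f)"
        using abs_convol_le[of f x] mult_left_mono[OF integral_abs_le_nrm[of f] J_nonneg[of 0]]
        by (simp add: sqfun_T)
    qed (simp add: J_nonneg)
    then show "nrm (T f) \<le> (?s * (J 0 * ?s)) * nrm f" by (simp add: mult.assoc)
  qed
qed (rule T_symmetric, rule T_compact)

lemma convol_eq_set_integral: "convol f x = (LINT y:U|lebesgue. J (x - y) * sqfun f y)"
  unfolding convol_def set_lebesgue_integral_def by (subst integral_restrict_space) auto

lemma eigenvalue_JU_if_nrm: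
  assumes "nrm w \<noteq> 0" "nrm (T w - m *\<^sub>R w) = 0"
  shows "eigenvalue_JU J U m"
  unfolding eigenvalue_JU_def
proof (intro exI[of _ "sqfun w"] conjI)
  show "set_integrable lebesgue U (\<lambda>x. (sqfun w x)\<^sup>2)"
    unfolding set_integrable_def by (rule integrable_mult_indicator[OF U_sets integrable_sqfun_square])
  show "\<not> (AE x in lebesgue. x \<in> U \<longrightarrow> sqfun w x = 0)"
    using assms(1) by (simp add: nrm_eq_0_iff)
  have "AE x in lebesgue. x \<in> U \<longrightarrow> sqfun (T w - m *\<^sub>R w) x = 0"
    using assms(2) by (simp only: nrm_eq_0_iff)
  then show "AE x in lebesgue. x \<in> U \<longrightarrow>
      (LINT y:U|lebesgue. J (x - y) * sqfun w y) = m * sqfun w x"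
    by eventually_elim
      (auto simp: minus_sqint.rep_eq scaleR_sqint.rep_eq sqfun_T convol_eq_set_integral)
qed simp

end

section \<open>Convergence of eigenvalues\<close>

text \<open>On \<open>\<Omega>n n\<close> the squared residual of the extended eigenfunction is at
  most \<open>b n\<close>, which tends to 0, while its squared norm \<open>S - s n\<close> tends to
  the positive \<open>S\<close>. Eventually the relative residual is below the tolerance, and
  \<open>eigenvalue_near\<close> applies.\<close>

lemma eventually_eigenvalue_JU_near:
  fixes J :: "'a::euclidean_space \<Rightarrow> real"
    and \<Omega> :: "'a set" and \<Omega>n :: "nat \<Rightarrow> 'a set"
  assumes H: "hypH J"
    and \<Omega>: "open \<Omega>" "bounded \<Omega>"
    and \<Omega>n: "\<And>n. open (\<Omega>n n)" "\<And>n. bounded (\<Omega>n n)"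
    and conv: "(\<lambda>n. measure lebesgue (\<Omega> - \<Omega>n n) + measure lebesgue (\<Omega>n n - \<Omega>)) \<longlonglongrightarrow> 0"
    and eig: "eigenvalue_JU J \<Omega> \<mu>"
    and "0 < e"
  shows "\<forall>\<^sub>F n in sequentially. \<exists>m. \<bar>m - \<mu>\<bar> < e \<and> eigenvalue_JU J (\<Omega>n n) m"
proof -
  interpret O: convolution_kernel J \<Omega>
    using H \<Omega> by unfold_locales
  have On: "convolution_kernel J (\<Omega>n n)" for n
    using H \<Omega>n by unfold_locales
  note [measurable] = convolution_kernel.U_sets[OF On]
  note nrm_sq = convolution_kernel.nrm_square_integral[OF On]
  have fm: "\<Omega> - \<Omega>n n \<in> fmeasurable lebesgue" "\<Omega>n n - \<Omega> \<in> fmeasurable lebesgue" for n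
    using O.U_lmeasurable convolution_kernel.U_lmeasurable[OF On]
    by (auto intro: fmeasurable_Diff)
  have m1: "(\<lambda>n. measure lebesgue (\<Omega> - \<Omega>n n)) \<longlonglongrightarrow> 0"
    by (rule tendsto_sandwich[OF _ _ tendsto_const conv]) auto
  have m2: "(\<lambda>n. measure lebesgue (\<Omega>n n - \<Omega>)) \<longlonglongrightarrow> 0"
    by (rule tendsto_sandwich[OF _ _ tendsto_const conv]) auto
  obtain u where u [measurable]: "u \<in> borel_measurable lebesgue"
    and u2: "set_integrable lebesgue \<Omega> (\<lambda>x. (u x)\<^sup>2)"
    and nz: "\<not> (AE x in lebesgue. x \<in> \<Omega> \<longrightarrow> u x = 0)"
    and ev: "AE x in lebesgue. x \<in> \<Omega> \<longrightarrow> (LINT y:\<Omega>|lebesgue. J (x - y) * u y) = \<mu> * u x"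
    using eig unfolding eigenvalue_JU_def by (elim exE conjE)
  define w where "w x = indicator \<Omega> x * u x" for x
  have w [measurable]: "w \<in> borel_measurable lebesgue"
    unfolding w_def by measurable
  have w2: "integrable lebesgue (\<lambda>x. (w x)\<^sup>2)"
    using u2 by (simp add: set_integrable_def w_def power_mult_distrib power2_eq_square[of "indicator _ _"]
        flip: indicator_inter_arith)
  define f where "f = Abs_sqint w"
  have f: "sqfun f = w" using w w2 by (simp add: f_def Abs_sqint_inverse)
  have wO: "w x = 0" if "x \<notin> \<Omega>" for x using that by (simp add: w_def)
  have w1: "integrable lebesgue w"
  proof -
    have "integrable lebesgue (\<lambda>x. indicator \<Omega> x *\<^sub>R w x)"
      using O.integrable_sqfun[of f] by (simp add: f integrable_restrict_space)
    moreover have "(\<lambda>x. indicator \<Omega> x *\<^sub>R w x) = w"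
      by (auto simp: w_def split: split_indicator)
    ultimately show ?thesis by (simp only:)
  qed
  define S where "S = (\<integral>x. (w x)\<^sup>2 \<partial>lebesgue)"
  have "S \<noteq> 0"
  proof
    assume "S = 0"
    then have "AE x in lebesgue. (w x)\<^sup>2 = 0"
      unfolding S_def by (subst (asm) integral_nonneg_eq_0_iff_AE[OF w2]) auto
    then have "AE x in lebesgue. x \<in> \<Omega> \<longrightarrow> u x = 0"
      by eventually_elim (auto simp: w_def)
    with nz show False by contradiction
  qed
  moreover have "0 \<le> S" unfolding S_def by (rule integral_nonneg_AE) simp
  ultimately have "0 < S" by simp
  define A where "A = (\<integral>x. \<bar>w x\<bar> \<partial>lebesgue)"
  have "0 \<le> A" unfolding A_def by (rule integral_nonneg_AE) simp
  \<comment> \<open>The mass and the squared norm of \<open>w\<close> lost by passing to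
    \<open>\<Omega>n n\<close>; both vanish in the limit by absolute continuity.\<close>
  define a where "a n = (LINT x:\<Omega> - \<Omega>n n|lebesgue. \<bar>w x\<bar>)" for n
  define s where "s n = (LINT x:\<Omega> - \<Omega>n n|lebesgue. (w x)\<^sup>2)" for n
  have a0: "a \<longlonglongrightarrow> 0"
    unfolding a_def[abs_def] by (rule set_integral_tendsto_0[OF _ _ fm(1) m1]) (use w1 in auto)
  have s0: "s \<longlonglongrightarrow> 0"
    unfolding s_def[abs_def] by (rule set_integral_tendsto_0[OF _ _ fm(1) m1]) (use w2 in auto)
  have a_nonneg: "0 \<le> a n" for n
    unfolding a_def set_lebesgue_integral_def by (rule integral_nonneg_AE) simp
  have split: "(LINT x:\<Omega>n n|lebesgue. h x) = integral\<^sup>L lebesgue h - (LINT x:\<Omega> - \<Omega>n n|lebesgue. h x)"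
    if h: "integrable lebesgue h" "\<And>x. x \<notin> \<Omega> \<Longrightarrow> h x = 0" for h :: "'a \<Rightarrow> real" and n
  proof -
    have "integral\<^sup>L lebesgue h = (\<integral>x. indicator (\<Omega>n n) x *\<^sub>R h x + indicator (\<Omega> - \<Omega>n n) x *\<^sub>R h x \<partial>lebesgue)"
      using h(2) by (intro Bochner_Integration.integral_cong refl) (auto split: split_indicator)
    also have "\<dots> = (LINT x:\<Omega>n n|lebesgue. h x) + (LINT x:\<Omega> - \<Omega>n n|lebesgue. h x)"
      unfolding set_lebesgue_integral_def
      by (intro Bochner_Integration.integral_add integrable_mult_indicator h(1)) (use fm in auto)
    finally show ?thesis by simp
  qed
  let ?nrm = "\<lambda>n. semi_inner_product.nrm (convolution_kernel.ip (\<Omega>n n))"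
  let ?T = "\<lambda>n. convolution_kernel.T J (\<Omega>n n)"
  have nrm_f: "(?nrm n f)\<^sup>2 = S - s n" for n
  proof -
    have "(?nrm n f)\<^sup>2 = (LINT x:\<Omega>n n|lebesgue. (w x)\<^sup>2)"
      unfolding nrm_sq f set_lebesgue_integral_def by (subst integral_restrict_space) auto
    also have "\<dots> = S - s n" unfolding S_def s_def by (rule split[OF w2]) (simp add: wO)
    finally show ?thesis .
  qed
  \<comment> \<open>Where \<open>\<Omega>n n\<close> meets \<open>\<Omega>\<close>, the eigenvalue
    equation leaves only the convolution over the lost part, at most \<open>J 0 * a n\<close>. On
    \<open>\<Omega>n n - \<Omega>\<close>, \<open>w\<close> is zero and the whole convolution
    remains, at most \<open>J 0 * A\<close>, but the set is small.\<close>
  define b where "b n = (J 0 * a n)\<^sup>2 * measure lebesgue \<Omega> + (J 0 * A)\<^sup>2 * measure lebesgue (\<Omega>n n - \<Omega>)" for n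
  have residual: "(?nrm n (?T n f - \<mu> *\<^sub>R f))\<^sup>2 \<le> b n" for n
  proof -
    interpret N: convolution_kernel J "\<Omega>n n" by (rule On)
    have Jw: "integrable lebesgue (\<lambda>y. J (x - y) * w y)" for x
    proof (rule Bochner_Integration.integrable_bound)
      show "integrable lebesgue (\<lambda>y. J 0 * w y)" using w1 by simp
      show "AE y in lebesgue. norm (J (x - y) * w y) \<le> norm (J 0 * w y)"
        using O.J_nonneg O.J_le by (intro AE_I2) (simp add: abs_mult mult_right_mono)
      have "continuous_on UNIV (\<lambda>y. J (x - y))"
        by (rule continuous_on_compose2[OF O.J_continuous]) (auto intro!: continuous_intros)
      then have "(\<lambda>y. J (x - y)) \<in> borel_measurable lborel"
        using borel_measurable_continuous_onI by simp
      then have "(\<lambda>y. J (x - y)) \<in> borel_measurable lebesgue" by (rule measurable_completion)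
      then show "(\<lambda>y. J (x - y) * w y) \<in> borel_measurable lebesgue" by simp
    qed
    have Jw_O: "(\<integral>y. J (x - y) * w y \<partial>lebesgue) = (LINT y:\<Omega>|lebesgue. J (x - y) * u y)" for x
      unfolding set_lebesgue_integral_def
      by (intro Bochner_Integration.integral_cong refl) (simp add: w_def)
    have conv_eq: "N.convol f x
        = (LINT y:\<Omega>|lebesgue. J (x - y) * u y) - (LINT y:\<Omega> - \<Omega>n n|lebesgue. J (x - y) * w y)" for x
      unfolding N.convol_eq_set_integral f Jw_O[symmetric]
      by (rule split[OF Jw]) (simp add: wO)
    have err: "\<bar>LINT y:\<Omega> - \<Omega>n n|lebesgue. J (x - y) * w y\<bar> \<le> J 0 * a n" for x
    proof -
      have "\<bar>LINT y:\<Omega> - \<Omega>n n|lebesgue. J (x - y) * w y\<bar>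
          \<le> (\<integral>y. \<bar>indicator (\<Omega> - \<Omega>n n) y *\<^sub>R (J (x - y) * w y)\<bar> \<partial>lebesgue)"
        unfolding set_lebesgue_integral_def by (rule integral_abs_bound)
      also have "\<dots> \<le> (\<integral>y. J 0 * (indicator (\<Omega> - \<Omega>n n) y *\<^sub>R \<bar>w y\<bar>) \<partial>lebesgue)"
      proof (rule integral_mono)
        show "integrable lebesgue (\<lambda>y. \<bar>indicator (\<Omega> - \<Omega>n n) y *\<^sub>R (J (x - y) * w y)\<bar>)"
          by (intro integrable_abs integrable_mult_indicator Jw) (use fm in auto)
        show "integrable lebesgue (\<lambda>y. J 0 * (indicator (\<Omega> - \<Omega>n n) y *\<^sub>R \<bar>w y\<bar>))"
          by (intro integrable_mult_right integrable_mult_indicator integrable_abs w1) (use fm in auto)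
        show "\<bar>indicator (\<Omega> - \<Omega>n n) y *\<^sub>R (J (x - y) * w y)\<bar>
            \<le> J 0 * (indicator (\<Omega> - \<Omega>n n) y *\<^sub>R \<bar>w y\<bar>)" for y
          using O.J_nonneg[of "x - y"] O.J_le[of "x - y"]
          by (auto simp: abs_mult mult_right_mono split: split_indicator)
      qed
      also have "\<dots> = J 0 * a n" by (simp add: a_def set_lebesgue_integral_def)
      finally show ?thesis .
    qed
    have conv_le: "\<bar>N.convol f x\<bar> \<le> J 0 * A" for x
    proof -
      have "(\<integral>y. \<bar>w y\<bar> \<partial>lebesgue_on (\<Omega>n n)) \<le> A"
      proof -
        have "(\<integral>y. \<bar>w y\<bar> \<partial>lebesgue_on (\<Omega>n n)) = (LINT x:\<Omega>n n|lebesgue. \<bar>w x\<bar>)"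
          unfolding set_lebesgue_integral_def by (subst integral_restrict_space) auto
        also have "\<dots> = A - a n"
          unfolding A_def a_def by (rule split) (use w1 wO in auto)
        finally show ?thesis using a_nonneg[of n] by simp
      qed
      from mult_left_mono[OF this O.J_nonneg[of 0]] show ?thesis
        using N.abs_convol_le[of f x] by (simp add: f)
    qed
    let ?r = "sqfun (N.T f - \<mu> *\<^sub>R f)"
    have "(N.nrm (N.T f - \<mu> *\<^sub>R f))\<^sup>2 = (\<integral>x. indicator (\<Omega>n n) x *\<^sub>R (?r x)\<^sup>2 \<partial>lebesgue)"
      unfolding N.nrm_square_integral by (subst integral_restrict_space) auto
    also have "\<dots> \<le> (\<integral>x. (J 0 * a n)\<^sup>2 * indicator \<Omega> x + (J 0 * A)\<^sup>2 * indicator (\<Omega>n n - \<Omega>) x \<partial>lebesgue)"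
    proof (rule integral_mono_AE)
      show "integrable lebesgue (\<lambda>x. indicator (\<Omega>n n) x *\<^sub>R (?r x)\<^sup>2)"
        by (intro integrable_mult_indicator integrable_sqfun_square) simp
      show "integrable lebesgue (\<lambda>x. (J 0 * a n)\<^sup>2 * indicator \<Omega> x + (J 0 * A)\<^sup>2 * indicator (\<Omega>n n - \<Omega>) x)"
        using O.U_lmeasurable fm(2)[of n] by (simp add: fmeasurable_def)
      show "AE x in lebesgue. indicator (\<Omega>n n) x *\<^sub>R (?r x)\<^sup>2
          \<le> (J 0 * a n)\<^sup>2 * indicator \<Omega> x + (J 0 * A)\<^sup>2 * indicator (\<Omega>n n - \<Omega>) x"
        using ev
      proof eventually_elim
        fix x assume x: "x \<in> \<Omega> \<longrightarrow> (LINT y:\<Omega>|lebesgue. J (x - y) * u y) = \<mu> * u x"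
        have r: "?r x = N.convol f x - \<mu> * w x" if "x \<in> \<Omega>n n"
          using that by (simp add: minus_sqint.rep_eq scaleR_sqint.rep_eq N.sqfun_T f)
        consider "x \<notin> \<Omega>n n" | "x \<in> \<Omega>n n" "x \<in> \<Omega>" | "x \<in> \<Omega>n n" "x \<notin> \<Omega>" by blast
        then show "indicator (\<Omega>n n) x *\<^sub>R (?r x)\<^sup>2
          \<le> (J 0 * a n)\<^sup>2 * indicator \<Omega> x + (J 0 * A)\<^sup>2 * indicator (\<Omega>n n - \<Omega>) x"
        proof cases
          case 1
          then show ?thesis by simp
        next
          case 2
          then have "\<bar>?r x\<bar> \<le> J 0 * a n"
            using err[of x] x by (simp add: r conv_eq w_def)
          from power_mono[OF this, of 2] 2 show ?thesis by simp
        next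
          case 3
          then have "\<bar>?r x\<bar> \<le> J 0 * A"
            using conv_le[of x] by (simp add: r wO)
          from power_mono[OF this, of 2] 3 show ?thesis by simp
        qed
      qed
    qed
    also have "\<dots> = b n"
      using O.U_lmeasurable fm(2)[of n]
      by (subst Bochner_Integration.integral_add) (auto simp: b_def fmeasurable_def)
    finally show ?thesis .
  qed
  have b0: "b \<longlonglongrightarrow> 0"
    unfolding b_def[abs_def]
    by (intro tendsto_add_zero tendsto_mult_left_zero tendsto_mult_right_zero tendsto_null_power a0 m2) simp
  \<comment> \<open>For nonzero \<open>\<mu>\<close> the tolerance is capped at
    \<open>\<bar>\<mu>\<bar>\<close>, as \<open>eigenvalue_near\<close> demands.\<close>
  define \<epsilon> where "\<epsilon> = (if \<mu> = 0 then e else min e \<bar>\<mu>\<bar>)"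
  have \<epsilon>: "0 < \<epsilon>" "\<epsilon> \<le> e" "\<mu> \<noteq> 0 \<Longrightarrow> \<epsilon> \<le> \<bar>\<mu>\<bar>" using \<open>0 < e\<close> by (auto simp: \<epsilon>_def)
  have "(\<lambda>n. \<epsilon>\<^sup>2 * (S - s n) - b n) \<longlonglongrightarrow> \<epsilon>\<^sup>2 * (S - 0) - 0"
    by (intro tendsto_intros s0 b0)
  then have "\<forall>\<^sub>F n in sequentially. 0 < \<epsilon>\<^sup>2 * (S - s n) - b n"
    by (rule order_tendstoD) (use \<open>0 < S\<close> \<epsilon> in simp)
  then show ?thesis
  proof eventually_elim
    case (elim n)
    interpret N: convolution_kernel J "\<Omega>n n" by (rule On)
    have "(N.nrm (N.T f - \<mu> *\<^sub>R f))\<^sup>2 < (\<epsilon> * N.nrm f)\<^sup>2"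
      using residual[of n] elim by (simp add: power_mult_distrib nrm_f)
    then have "N.nrm (N.T f - \<mu> *\<^sub>R f) < \<epsilon> * N.nrm f"
      by (rule power_less_imp_less_base) (use \<epsilon> in simp)
    then obtain m g where "\<bar>m - \<mu>\<bar> < \<epsilon>" "N.nrm g \<noteq> 0" "N.nrm (N.T g - m *\<^sub>R g) = 0"
      by (rule N.eigenvalue_near) (rule \<epsilon>(3))
    with \<epsilon>(2) show "\<exists>m. \<bar>m - \<mu>\<bar> < e \<and> eigenvalue_JU J (\<Omega>n n) m"
      by (intro exI[of _ m]) (simp add: N.eigenvalue_JU_if_nrm)
  qed
qed

text \<open>To get one sequence independent of \<open>e\<close>, \<open>m n\<close> is taken almost
  nearest to \<open>\<mu>\<close> among the points satisfying \<open>P n\<close>, within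
  \<open>1 / (n + 1)\<close> of the infimal distance. Any witness for a given \<open>e\<close>
  bounds that infimum. Where \<open>P n\<close> has no point, \<open>m n\<close> is
  arbitrary.\<close>

lemma tendsto_selection:
  fixes P :: "nat \<Rightarrow> real \<Rightarrow> bool"
  assumes near: "\<And>e. 0 < e \<Longrightarrow> \<forall>\<^sub>F n in sequentially. \<exists>m. \<bar>m - \<mu>\<bar> < e \<and> P n m"
  obtains m where "m \<longlonglongrightarrow> \<mu>" "\<forall>\<^sub>F n in sequentially. P n (m n)"
proof -
  define D where "D n = (\<lambda>m. \<bar>m - \<mu>\<bar>) ` {m. P n m}" for n
  have bdd: "bdd_below (D n)" for n by (auto simp: D_def intro: bdd_belowI[of _ 0])
  have "\<exists>m. P n m \<and> \<bar>m - \<mu>\<bar> < Inf (D n) + inverse (real (Suc n))" if "\<exists>m. P n m" for n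
    using cInf_lessD[of "D n" "Inf (D n) + inverse (real (Suc n))"] that by (auto simp: D_def)
  then obtain m where m: "\<And>n. \<exists>m. P n m \<Longrightarrow>
      P n (m n) \<and> \<bar>m n - \<mu>\<bar> < Inf (D n) + inverse (real (Suc n))"
    by metis
  have P: "\<forall>\<^sub>F n in sequentially. P n (m n)"
    using near[OF zero_less_one] by eventually_elim (use m in blast)
  have "m \<longlonglongrightarrow> \<mu>"
  proof (rule tendstoI)
    fix e :: real assume "0 < e"
    then have "0 < e / 2" by simp
    have "\<forall>\<^sub>F n in sequentially. inverse (real (Suc n)) < e / 2"
      using order_tendstoD(2)[OF LIMSEQ_inverse_real_of_nat \<open>0 < e / 2\<close>] .
    with near[OF \<open>0 < e / 2\<close>] show "\<forall>\<^sub>F n in sequentially. dist (m n) \<mu> < e"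
    proof eventually_elim
      case (elim n)
      then obtain k where k: "\<bar>k - \<mu>\<bar> < e / 2" "P n k" by blast
      have "Inf (D n) \<le> \<bar>k - \<mu>\<bar>"
        by (rule cInf_lower[OF _ bdd]) (use k in \<open>auto simp: D_def\<close>)
      moreover have "\<bar>m n - \<mu>\<bar> < Inf (D n) + inverse (real (Suc n))" using m k by blast
      ultimately show ?case using k elim by (simp add: dist_real_def)
    qed
  qed
  with P show thesis by (rule that[rotated])
qed

text \<open>The eigenfunctions are the same up to extension by zero: \<open>eigenvalue_JU\<close>
  looks at \<open>u\<close> on \<open>U\<close> only, whereas \<open>eigenvalue_BU\<close> asks it
  to vanish elsewhere, so one direction multiplies \<open>u\<close> by the indicator of
  \<open>U\<close>.\<close>

lemma eigenvalue_BU_iff: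
  fixes U :: "'a::euclidean_space set"
  assumes "open U"
  shows "eigenvalue_BU J U lam \<longleftrightarrow> eigenvalue_JU J U (1 - lam)"
proof
  have U [measurable]: "U \<in> sets lebesgue" using assms by (simp add: borel_open)
  show "eigenvalue_JU J U (1 - lam)" if "eigenvalue_BU J U lam"
  proof -
    from that obtain u where u: "u \<in> borel_measurable lebesgue" "integrable lebesgue (\<lambda>x. (u x)\<^sup>2)"
      and out: "\<forall>x. x \<notin> U \<longrightarrow> u x = 0" and nz: "\<not> (AE x in lebesgue. u x = 0)"
      and ev: "AE x in lebesgue. x \<in> U \<longrightarrow> (LINT y|lebesgue. J (x - y) * u y) - u x = - lam * u x"
      unfolding eigenvalue_BU_def by (elim exE conjE)
    have int: "(LINT y:U|lebesgue. J (x - y) * u y) = (LINT y|lebesgue. J (x - y) * u y)" for x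
      unfolding set_lebesgue_integral_def
      by (intro Bochner_Integration.integral_cong refl) (use out in \<open>auto split: split_indicator\<close>)
    show ?thesis
      unfolding eigenvalue_JU_def
    proof (intro exI[of _ u] conjI u(1))
      show "set_integrable lebesgue U (\<lambda>x. (u x)\<^sup>2)"
        unfolding set_integrable_def by (rule integrable_mult_indicator[OF U u(2)])
      have "(x \<in> U \<longrightarrow> u x = 0) \<longleftrightarrow> u x = 0" for x using out by blast
      with nz show "\<not> (AE x in lebesgue. x \<in> U \<longrightarrow> u x = 0)" by simp
      show "AE x in lebesgue. x \<in> U \<longrightarrow> (LINT y:U|lebesgue. J (x - y) * u y) = (1 - lam) * u x"
        unfolding int using ev by eventually_elim (simp add: algebra_simps)
    qed
  qed
  show "eigenvalue_BU J U lam" if "eigenvalue_JU J U (1 - lam)"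
  proof -
    from that obtain u where u [measurable]: "u \<in> borel_measurable lebesgue"
      and u2: "set_integrable lebesgue U (\<lambda>x. (u x)\<^sup>2)"
      and nz: "\<not> (AE x in lebesgue. x \<in> U \<longrightarrow> u x = 0)"
      and ev: "AE x in lebesgue. x \<in> U \<longrightarrow> (LINT y:U|lebesgue. J (x - y) * u y) = (1 - lam) * u x"
      unfolding eigenvalue_JU_def by (elim exE conjE)
    define w where "w x = indicator U x * u x" for x
    have int: "(LINT y|lebesgue. J (x - y) * w y) = (LINT y:U|lebesgue. J (x - y) * u y)" for x
      unfolding set_lebesgue_integral_def
      by (intro Bochner_Integration.integral_cong refl) (simp add: w_def)
    show ?thesis
      unfolding eigenvalue_BU_def
    proof (intro exI[of _ w] conjI allI impI)
      show "w \<in> borel_measurable lebesgue" unfolding w_def by measurable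
      show "integrable lebesgue (\<lambda>x. (w x)\<^sup>2)"
        using u2 by (simp add: set_integrable_def w_def power_mult_distrib power2_eq_square[of "indicator _ _"]
            flip: indicator_inter_arith)
      show "w x = 0" if "x \<notin> U" for x using that by (simp add: w_def)
      have "(x \<in> U \<longrightarrow> u x = 0) \<longleftrightarrow> w x = 0" for x by (auto simp: w_def)
      with nz show "\<not> (AE x in lebesgue. w x = 0)" by simp
      show "AE x in lebesgue. x \<in> U \<longrightarrow> (LINT y|lebesgue. J (x - y) * w y) - w x = - lam * w x"
        unfolding int using ev by eventually_elim (simp add: w_def algebra_simps)
    qed
  qed
qed

theorem theorem1p1:
  fixes J :: "'a::euclidean_space \<Rightarrow> real"
    and \<Omega> :: "'a set" and \<Omega>n :: "nat \<Rightarrow> 'a set"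
  assumes H: "hypH J"
    and \<Omega>: "open \<Omega>" "bounded \<Omega>"
    and \<Omega>n: "\<And>n. open (\<Omega>n n)" "\<And>n. bounded (\<Omega>n n)"
    and conv: "(\<lambda>n. measure lebesgue (\<Omega> - \<Omega>n n) + measure lebesgue (\<Omega>n n - \<Omega>)) \<longlonglongrightarrow> 0"
  shows "(\<forall>\<mu>. eigenvalue_JU J \<Omega> \<mu> \<longrightarrow>
            (\<exists>m::nat \<Rightarrow> real. m \<longlonglongrightarrow> \<mu> \<and>
               (\<forall>\<^sub>F n in sequentially. eigenvalue_JU J (\<Omega>n n) (m n))))
       \<and> (\<forall>lam. eigenvalue_BU J \<Omega> lam \<longrightarrow>
            (\<exists>l::nat \<Rightarrow> real. l \<longlonglongrightarrow> lam \<and>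
               (\<forall>\<^sub>F n in sequentially. eigenvalue_BU J (\<Omega>n n) (l n))))"
proof -
  \<comment> \<open>Eigenvalues can be asked for only eventually in \<open>n\<close>: finitely many
    \<open>\<Omega>n n\<close> may be empty, and the empty set has none.\<close>
  have JU: "\<exists>m. m \<longlonglongrightarrow> \<mu> \<and> (\<forall>\<^sub>F n in sequentially. eigenvalue_JU J (\<Omega>n n) (m n))"
    if "eigenvalue_JU J \<Omega> \<mu>" for \<mu>
    using tendsto_selection[OF eventually_eigenvalue_JU_near[OF H \<Omega> \<Omega>n conv that]] by metis
  \<comment> \<open>Transferred from the first part by the continuous substitution of
    \<open>1 - lam\<close> for \<open>lam\<close>, on \<open>\<Omega>\<close> and on each
    \<open>\<Omega>n n\<close>.\<close>
  moreover have "\<exists>l. l \<longlonglongrightarrow> lam \<and> (\<forall>\<^sub>F n in sequentially. eigenvalue_BU J (\<Omega>n n) (l n))"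
    if "eigenvalue_BU J \<Omega> lam" for lam
  proof -
    have "eigenvalue_JU J \<Omega> (1 - lam)" using that eigenvalue_BU_iff[OF \<Omega>(1)] by blast
    then obtain m where m: "m \<longlonglongrightarrow> 1 - lam" "\<forall>\<^sub>F n in sequentially. eigenvalue_JU J (\<Omega>n n) (m n)"
      using JU by blast
    have "(\<lambda>n. 1 - m n) \<longlonglongrightarrow> 1 - (1 - lam)" by (intro tendsto_intros m(1))
    with m(2) \<Omega>n(1) show ?thesis
      by (intro exI[of _ "\<lambda>n. 1 - m n"]) (simp add: eigenvalue_BU_iff)
  qed
  ultimately show ?thesis by blast
qed

end
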